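(* There is an exact sequence $$0\longrightarrow W_2(\mathcal C)\longrightarrow \mathrm{Sel}_2(\mathcal C)\xrightarrow{\ \mathrm{cl}\ }\mathrm{Cl}^+(k)^2[2]\longrightarrow 0,$$ where the first map is inclusion and $\mathrm{cl}$ sends $a\mathbb Q^{\times2}$ (with $a$ a positive squarefree divisor of $\Delta$) to the narrow ideal class of the ambiguous ideal $\mathfrak a$ of $\mathcal O_k$ with norm $a$. In particular $\text{Ш}_2(\mathcal C)\simeq \mathrm{Cl}^+(k)^2[2]$.
   Context: Let $d$ be a squarefree integer with $d\neq 1$, and put $\Delta=d$ if $d\equiv 1\pmod 4$ and $\Delta=4d$ if $d\equiv 2,3\pmod 4$; let $k=\mathbb Q(\sqrt\Delta)$, the quadratic field of discriminant $\Delta$, with ring of integers $\mathcal O_k$, and let $\mathrm{Cl}^+(k)$ be its narrow ideal class group; for an abelian group $G$, $G^2=\{g^2\}$ and $G^2[2]$ is the set of elements of $G^2$ of order dividing $2$. For a positive squarefree divisor $a$ of $\Delta$, put $b=\Delta/a$ and let $\mathcal T_a$ be the curve $ar^2-bs^2=4$; the ambiguous ideal of norm $a$ is the unique ideal $\mathfrak a$ of $\mathcal O_k$ equal to its conjugate and of norm $a$ (the product of the ramified primes over the primes dividing $a$). The $2$-Selmer group $\mathrm{Sel}_2(\mathcal C)$ is the subgroup of $\mathbb Q^\times/\mathbb Q^{\times2}$ consisting of the classes $a\mathbb Q^{\times2}$, $a$ a positive squarefree divisor of $\Delta$, such that $\mathcal T_a$ has a rational point; $W_2(\mathcal C)$ is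 its subgroup of those classes for which $\mathcal T_a$ has an integral point; and $\text{Ш}_2(\mathcal C)=\mathrm{Sel}_2(\mathcal C)/W_2(\mathcal C)$. *)

theory Defs
  imports
    Complex_Main
    "HOL-Computational_Algebra.Polynomial"
    "HOL-Computational_Algebra.Squarefree"
    "HOL-Algebra.Algebra"
begin

section \<open>Group-theoretic notions\<close>

definition squares_2torsion :: "('a, 'b) monoid_scheme \<Rightarrow> 'a set" where
  "squares_2torsion G =
     {x \<in> (\<lambda>g. g \<otimes>\<^bsub>G\<^esub> g) ` carrier G. x \<otimes>\<^bsub>G\<^esub> x = \<one>\<^bsub>G\<^esub>}"

text \<open>The library constant \<open>short_exact_sequence\<close> forces all groups to have elements of
  the same type, hence this heterogeneous version.\<close>

definition short_exact ::
    "('a, 'm) monoid_scheme \<Rightarrow> ('b, 'n) monoid_scheme \<Rightarrow> ('c, 'k) monoid_scheme \<Rightarrow>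
     ('a \<Rightarrow> 'b) \<Rightarrow> ('b \<Rightarrow> 'c) \<Rightarrow> bool" where
  "short_exact A B C f g \<longleftrightarrow>
     group A \<and> group B \<and> group C \<and>
     f \<in> mon A B \<and> g \<in> epi B C \<and> f ` carrier A = kernel B C g"


section \<open>Quadratic fields and their narrow class groups\<close>

definition quad_disc :: "int \<Rightarrow> int" where
  "quad_disc d = (if d mod 4 = 1 then d else 4 * d)"

definition ring_on :: "'a::ring_1 set \<Rightarrow> 'a ring" where
  "ring_on S = \<lparr>carrier = S, mult = (*), one = 1, ring.zero = 0, add = (+)\<rparr>"

definition quad_field :: "int \<Rightarrow> complex set" where
  "quad_field D = {p + q * csqrt (of_int D) | p q. p \<in> \<rat> \<and> q \<in> \<rat>}"

definition quad_ints :: "int \<Rightarrow> complex set" where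
  "quad_ints D = {x \<in> quad_field D. algebraic_int x}"

text \<open>The image of \<open>S \<subseteq> \<rat>(\<surd>D)\<close> under the nontrivial automorphism; this is not
  complex conjugation when \<open>D > 0\<close>.\<close>

definition quad_conj :: "int \<Rightarrow> complex set \<Rightarrow> complex set" where
  "quad_conj D S =
     {p - q * csqrt (of_int D) | p q. p \<in> \<rat> \<and> q \<in> \<rat> \<and> p + q * csqrt (of_int D) \<in> S}"

text \<open>If \<open>D < 0\<close> there are no real embeddings, and every nonzero element is totally positive.\<close>

definition totally_positive :: "int \<Rightarrow> complex \<Rightarrow> bool" where
  "totally_positive D x \<longleftrightarrow> x \<in> quad_field D \<and> x \<noteq> 0 \<and>
     (\<forall>\<sigma> \<in> ring_hom (ring_on (quad_field D)) (ring_on (UNIV :: real set)). \<sigma> x > 0)"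

definition fractional_ideal :: "int \<Rightarrow> complex set \<Rightarrow> bool" where
  "fractional_ideal D J \<longleftrightarrow>
     J \<subseteq> quad_field D \<and> 0 \<in> J \<and> J \<noteq> {0} \<and>
     (\<forall>x\<in>J. \<forall>y\<in>J. x + y \<in> J) \<and>
     (\<forall>c\<in>quad_ints D. \<forall>x\<in>J. c * x \<in> J) \<and>
     (\<exists>c\<in>quad_ints D. c \<noteq> 0 \<and> (\<forall>x\<in>J. c * x \<in> quad_ints D))"

definition ideal_group :: "int \<Rightarrow> complex set monoid" where
  "ideal_group D =
     \<lparr>carrier = {J. fractional_ideal D J},
      mult = ideal_prod (ring_on (quad_field D)),
      one = quad_ints D\<rparr>"

definition narrow_principal :: "int \<Rightarrow> complex set set" where
  "narrow_principal D = {(\<lambda>y. x * y) ` quad_ints D | x. totally_positive D x}"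

definition narrow_class_group :: "int \<Rightarrow> complex set set monoid" where
  "narrow_class_group D = ideal_group D Mod narrow_principal D"

definition narrow_class :: "int \<Rightarrow> complex set \<Rightarrow> complex set set" where
  "narrow_class D J = narrow_principal D #>\<^bsub>ideal_group D\<^esub> J"

definition Cl2_2 :: "int \<Rightarrow> complex set set monoid" where
  "Cl2_2 D = (narrow_class_group D)\<lparr>carrier := squares_2torsion (narrow_class_group D)\<rparr>"

definition ambiguous_ideal :: "int \<Rightarrow> nat \<Rightarrow> complex set" where
  "ambiguous_ideal D a =
     (THE I. ideal I (ring_on (quad_ints D)) \<and> quad_conj D I = I \<and>
             Coset.order (ring_on (quad_ints D) Quot I) = a)"


section \<open>The 2-Selmer and Tate--Shafarevich groups of the Pell conic\<close>

definition rat_units :: "rat monoid" where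
  "rat_units = \<lparr>carrier = - {0}, mult = (*), one = 1\<rparr>"

definition rat_unit_squares :: "rat set" where
  "rat_unit_squares = {x ^ 2 | x. x \<noteq> 0}"

definition square_class :: "nat \<Rightarrow> rat set" where
  "square_class a = rat_unit_squares #>\<^bsub>rat_units\<^esub> of_nat a"

definition sqfree_divisor :: "int \<Rightarrow> nat \<Rightarrow> bool" where
  "sqfree_divisor D a \<longleftrightarrow> a > 0 \<and> squarefree a \<and> int a dvd D"

text \<open>The points of \<open>a r\<^sup>2 - b s\<^sup>2 = 4\<close>, \<open>b = D / a\<close>, with coordinates in
  the ring \<open>'a\<close>.\<close>

definition torsor :: "int \<Rightarrow> nat \<Rightarrow> ('a::comm_ring_1 \<times> 'a) set" where
  "torsor D a = {(r, s). of_nat a * r ^ 2 - of_int (D div int a) * s ^ 2 = 4}"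

definition Sel2_set :: "int \<Rightarrow> rat set set" where
  "Sel2_set D = {square_class a | a. sqfree_divisor D a \<and> (torsor D a :: (rat \<times> rat) set) \<noteq> {}}"

definition W2_set :: "int \<Rightarrow> rat set set" where
  "W2_set D = {square_class a | a. sqfree_divisor D a \<and> (torsor D a :: (int \<times> int) set) \<noteq> {}}"

definition Sel2 :: "int \<Rightarrow> rat set monoid" where
  "Sel2 D = (rat_units Mod rat_unit_squares)\<lparr>carrier := Sel2_set D\<rparr>"

definition W2 :: "int \<Rightarrow> rat set monoid" where
  "W2 D = (Sel2 D)\<lparr>carrier := W2_set D\<rparr>"

definition Sha2 :: "int \<Rightarrow> rat set set monoid" where
  "Sha2 D = Sel2 D Mod W2_set D"

end

theory Submission
  imports Defs
begin

text \<open>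
  A rational point of \<open>a r\<^sup>2 - b s\<^sup>2 = 4\<close> is the same as an element \<open>(a r + s \<surd>\<Delta>) / 2\<close> of norm
  \<open>a\<close>, and an integral point is the same as such an element inside the ambiguous ideal \<open>\<aa>\<close>. Having
  the same norm as \<open>\<aa>\<close>, it generates \<open>\<aa>\<close>, and since \<open>a > 0\<close> it is totally positive up to sign. This
  identifies the kernel of \<open>cl\<close>.

  By Hilbert 90 for ideals, the squares in the narrow class group are the classes of the ideals of
  norm \<open>1\<close>: if \<open>J\<close> has norm \<open>1\<close>, then \<open>\<bb> = \<O> + J\<close> satisfies \<open>J \<bb>' = \<bb>\<close>, hence \<open>J = \<bb>\<^sup>2 / N\<bb>\<close>. If
  moreover \<open>J\<^sup>2 = (\<gamma>)\<close> with \<open>\<gamma>\<close> totally positive, then \<open>\<gamma>\<close> has norm \<open>1\<close> and equals \<open>\<delta>\<^sup>2 / N\<delta>\<close> with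
  \<open>\<delta>\<close> totally positive, and the ideal \<open>J / \<delta>\<close> is stable under conjugation. So the 2-torsion of the
  squares consists of the classes of the stable ideals whose norm is the norm of an element, and for
  a fundamental discriminant the stable ideals are the rational multiples of the ambiguous ideals of
  squarefree norm \<open>a\<close> dividing \<open>\<Delta>\<close>.
\<close>

section \<open>Arithmetic of integers and rational numbers\<close>

lemma squarefree_dvd_power_imp_dvd:
  fixes a x :: "'a::factorial_semiring"
  assumes "squarefree a" "a dvd x ^ n"
  shows "a dvd x"
proof (cases "x = 0")
  case False
  have "a \<noteq> 0" using assms(1) by auto
  show ?thesis
  proof (rule multiplicity_le_imp_dvd[OF \<open>a \<noteq> 0\<close>])
    fix p :: 'a assume prime_p: "Factorial_Ring.prime p"
    show "multiplicity p a \<le> multiplicity p x"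
    proof (cases "p dvd a")
      case True
      hence "p dvd x" using prime_p assms(2) by (blast dest: dvd_trans prime_dvd_power)
      hence "multiplicity p x \<ge> 1"
        using prime_p False by (simp add: multiplicity_gt_zero_iff Suc_le_eq)
      moreover have "multiplicity p a \<le> 1"
        using assms(1) prime_p \<open>a \<noteq> 0\<close> squarefree_factorial_semiring'' by blast
      ultimately show ?thesis by linarith
    qed (simp add: not_dvd_imp_multiplicity_0)
  qed
qed simp

lemma squarefree_eq_if_square_multiples_eq:
  fixes a b x y :: nat
  assumes "squarefree a" "squarefree b" "x > 0" "y > 0" and multiples_eq: "a * x ^ 2 = b * y ^ 2"
  shows "a = b"
proof (rule multiplicity_eq_nat)
  show "a > 0" "b > 0" using assms(1,2) by (auto intro: gr0I)
  fix p :: nat assume prime_p: "Factorial_Ring.prime p"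
  have "multiplicity p (c * z ^ 2) = multiplicity p c + 2 * multiplicity p z"
    if "c > 0" "z > 0" for c z
    using that prime_p
    by (simp add: prime_elem_multiplicity_mult_distrib prime_elem_multiplicity_power_distrib)
  hence "multiplicity p a + 2 * multiplicity p x = multiplicity p b + 2 * multiplicity p y"
    using \<open>a > 0\<close> \<open>b > 0\<close> assms(3,4) multiples_eq by metis
  moreover have "multiplicity p a \<le> 1" "multiplicity p b \<le> 1"
    using assms(1,2) prime_p \<open>a > 0\<close> \<open>b > 0\<close> squarefree_factorial_semiring'' by auto
  ultimately show "multiplicity p a = multiplicity p b" by presburger
qed

lemma int_square_mod_4: "x ^ 2 mod 4 \<in> {0, 1}" for x :: int
proof -
  have "x mod 4 \<in> {0, 1, 2, 3}" by auto
  thus ?thesis by (auto simp: power2_eq_square mod_mult_eq[of x 4 x, symmetric])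
qed

lemma odd_square_mod_4: "odd x \<Longrightarrow> x ^ 2 mod 4 = 1" for x :: int
proof -
  assume "odd x"
  hence "odd (x ^ 2 mod 4)" by (simp add: dvd_mod_iff)
  thus ?thesis using int_square_mod_4[of x] by auto
qed

lemma rat_square_eq_int_imp_Ints:
  fixes x :: rat
  assumes "x ^ 2 = of_int n"
  shows "x \<in> \<int>"
proof (rule rational_algebraic_int_is_int)
  show "algebraic_int x"
  proof (rule algebraic_int.intros)
    show "\<forall>i. Polynomial.coeff [:- of_int n, 0, 1 :: rat:] i \<in> \<int>"
      by (auto simp: coeff_pCons split: nat.splits)
    show "poly [:- of_int n, 0, 1:] x = 0" using assms by (simp add: power2_eq_square)
  qed simp
qed (metis Rats_of_rat of_rat_eq_id id_apply)

lemma rat_denominator: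
  fixes r :: rat
  obtains m z :: int where "m > 0" "of_int m * r = of_int z"
proof -
  obtain z m where "quotient_of r = (z, m)" by fastforce
  hence "m > 0" "r = of_int z / of_int m" using quotient_of_denom_pos quotient_of_div by auto
  thus thesis using that[of m z] by simp
qed

lemma Ints_if_powers_common_denominator:
  fixes r :: rat and m :: int
  assumes "m > 0" and powers: "\<And>k. of_int m * r ^ k \<in> \<int>"
  shows "r \<in> \<int>"
proof -
  obtain p q where quotient: "quotient_of r = (p, q)" by fastforce
  have "q > 0" and coprime: "coprime p q" and r_eq: "r = of_int p / of_int q"
    using quotient_of_denom_pos[OF quotient] quotient_of_coprime[OF quotient]
      quotient_of_div[OF quotient] by auto
  have bound: "q ^ k \<le> m" for k
  proof -
    obtain z where "of_int m * r ^ k = of_int z" using powers[of k] by (auto elim: Ints_cases)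
    hence "(of_int (m * p ^ k) :: rat) = of_int (z * q ^ k)"
      using \<open>q > 0\<close> by (simp add: r_eq power_divide field_simps)
    hence "m * p ^ k = z * q ^ k" by (simp only: of_int_eq_iff)
    hence "q ^ k dvd m * p ^ k" by simp
    hence "q ^ k dvd m"
      using coprime by (simp add: coprime_commute coprime_dvd_mult_left_iff)
    thus ?thesis using \<open>m > 0\<close> by (simp add: zdvd_imp_le)
  qed
  have "q = 1"
  proof (rule ccontr)
    assume "q \<noteq> 1"
    hence "2 ^ nat m \<le> q ^ nat m" using \<open>q > 0\<close> by (intro power_mono) auto
    hence "2 ^ nat m \<le> m" using bound[of "nat m"] by linarith
    moreover have "int (nat m) < int (2 ^ nat m)" by (simp only: of_nat_less_iff less_exp)
    ultimately show False using \<open>m > 0\<close> by simp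
  qed
  thus ?thesis using r_eq by simp
qed

lemma int_subgroup_cyclic:
  fixes S :: "int set"
  assumes "S \<noteq> {}" and diff: "\<And>x y. x \<in> S \<Longrightarrow> y \<in> S \<Longrightarrow> x - y \<in> S"
  obtains n where "n \<ge> 0" "S = range (\<lambda>k. k * n)"
proof -
  have zero: "0 \<in> S" using assms by (metis all_not_in_conv diff_self)
  have minus: "- x \<in> S" if "x \<in> S" for x using diff[OF zero that] by simp
  have mult: "k * x \<in> S" if in_S: "x \<in> S" for k x
  proof (induction k rule: int_induct[where k = 0])
    case (step1 i) thus ?case using diff[OF _ minus[OF in_S]] by (simp add: distrib_right)
  next
    case (step2 i) thus ?case using diff[OF _ in_S] by (simp add: left_diff_distrib)
  qed (simp add: zero)
  show thesis
  proof (cases "S = {0}")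
    case False
    define n where "n = (LEAST n. n > 0 \<and> int n \<in> S)"
    obtain x where "x \<in> S" "x \<noteq> 0" using False zero by blast
    hence "int (nat \<bar>x\<bar>) \<in> S" "nat \<bar>x\<bar> > 0" using minus by (auto simp: abs_if)
    hence "\<exists>n>0. int n \<in> S" by blast
    hence "n > 0" "int n \<in> S" unfolding n_def using LeastI_ex[of "\<lambda>n. n > 0 \<and> int n \<in> S"] by auto
    have "int n dvd x" if "x \<in> S" for x
    proof -
      have "x mod int n \<in> S"
        using diff[OF that mult[OF \<open>int n \<in> S\<close>, of "x div int n"]]
        by (simp add: minus_div_mult_eq_mod)
      moreover have "nat (x mod int n) < n" "x mod int n \<ge> 0"
        using \<open>n > 0\<close> by (auto simp: nat_less_iff)
      ultimately have "x mod int n = 0"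
        using not_less_Least[of "nat (x mod int n)" "\<lambda>n. n > 0 \<and> int n \<in> S"] by (auto simp: n_def)
      thus ?thesis by auto
    qed
    hence "S = range (\<lambda>k. k * int n)"
      using mult[OF \<open>int n \<in> S\<close>] by (force elim!: dvdE simp: mult.commute)
    thus thesis by (rule that[rotated]) simp
  qed (use that[of 0] in auto)
qed

lemma rat_subgroup_cyclic:
  fixes S :: "rat set" and c :: int
  assumes diff: "\<And>x y. x \<in> S \<Longrightarrow> y \<in> S \<Longrightarrow> x - y \<in> S"
    and "c > 0" and denominator: "\<And>x. x \<in> S \<Longrightarrow> of_int c * x \<in> \<int>"
    and nonzero: "\<exists>x\<in>S. x \<noteq> 0"
  obtains g where "g > 0" "\<And>x. x \<in> S \<longleftrightarrow> x / g \<in> \<int>"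
proof -
  define T where "T = {z :: int. of_int z / of_int c \<in> S}"
  have S_eq: "S = (\<lambda>z. of_int z / of_int c) ` T"
  proof
    show "S \<subseteq> (\<lambda>z. of_int z / of_int c) ` T"
    proof
      fix x assume "x \<in> S"
      then obtain z where "of_int c * x = of_int z" using denominator by (auto elim: Ints_cases)
      hence "x = of_int z / of_int c" using \<open>c > 0\<close> by (simp add: field_simps)
      thus "x \<in> (\<lambda>z. of_int z / of_int c) ` T" using \<open>x \<in> S\<close> by (auto simp: T_def)
    qed
  qed (auto simp: T_def)
  have "T \<noteq> {}" using nonzero S_eq by auto
  moreover have "x - y \<in> T" if "x \<in> T" "y \<in> T" for x y
    using diff that by (simp add: T_def diff_divide_distrib)
  ultimately obtain n where "n \<ge> 0" and T_eq: "T = range (\<lambda>k. k * n)"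
    using int_subgroup_cyclic[of T] by metis
  hence "n > 0" using nonzero \<open>n \<ge> 0\<close> unfolding S_eq T_eq by (cases "n = 0") auto
  define g where "g = (of_int n / of_int c :: rat)"
  have "g > 0" using \<open>n > 0\<close> \<open>c > 0\<close> by (simp add: g_def)
  have "S = range (\<lambda>k. of_int k * g)" unfolding S_eq T_eq image_image g_def by simp
  hence "x \<in> S \<longleftrightarrow> x / g \<in> \<int>" for x
    using \<open>g > 0\<close> by (auto simp: image_iff field_simps elim!: Ints_cases)
  thus thesis using that \<open>g > 0\<close> by blast
qed

lemma card_range_mod_lattice:
  fixes f :: "int \<Rightarrow> int \<Rightarrow> 'a" and m n t :: int
  assumes "m > 0" "n > 0"
    and eq_iff: "\<And>i j i' j'. f i j = f i' j' \<longleftrightarrow> m dvd j - j' \<and> n dvd (i - i') - t * (j - j')"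
  shows "card (range (\<lambda>(i, j). f i j)) = nat (n * m)"
proof -
  let ?f = "\<lambda>(i, j). f i j" and ?R = "{0..<n} \<times> {0..<m}"
  have "inj_on ?f ?R"
  proof (rule inj_onI, clarify)
    fix i j i' j' assume f_eq: "f i j = f i' j'"
      and range: "i \<in> {0..<n}" "j \<in> {0..<m}" "i' \<in> {0..<n}" "j' \<in> {0..<m}"
    have "j = j'" using f_eq range by (simp add: eq_iff) (metis mod_eq_dvd_iff mod_pos_pos_trivial)
    moreover from this have "i = i'"
      using f_eq range by (simp add: eq_iff) (metis mod_eq_dvd_iff mod_pos_pos_trivial)
    ultimately show "i = i' \<and> j = j'" by simp
  qed
  moreover have "range ?f = ?f ` ?R"
  proof
    show "range ?f \<subseteq> ?f ` ?R"
    proof clarify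
      fix i j
      define j' where "j' = j mod m"
      define i' where "i' = (i - t * (j - j')) mod n"
      have "m dvd j - j'" "n dvd (i - t * (j - j')) - i'"
        by (simp_all add: i'_def j'_def minus_mod_eq_mult_div)
      hence "f i j = f i' j'" by (simp add: eq_iff algebra_simps)
      moreover have "(i', j') \<in> ?R" using assms(1,2) by (simp add: i'_def j'_def)
      ultimately show "f i j \<in> ?f ` ?R" by force
    qed
  qed auto
  ultimately show ?thesis using assms(1,2) by (simp add: card_image nat_mult_distrib)
qed

section \<open>Fundamental discriminants\<close>

definition fundamental_discriminant :: "int \<Rightarrow> bool" where
  "fundamental_discriminant D \<longleftrightarrow>
     D \<noteq> 1 \<and> D mod 4 \<in> {0, 1} \<and> (\<forall>h E. D = h ^ 2 * E \<and> E mod 4 \<in> {0, 1} \<longrightarrow> is_unit h)"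

lemma fundamental_discriminant_quad_disc:
  assumes "squarefree d" "d \<noteq> 1"
  shows "fundamental_discriminant (quad_disc d)"
proof (cases "d mod 4 = 1")
  case True
  thus ?thesis using assms by (auto simp: fundamental_discriminant_def quad_disc_def squarefree_def)
next
  case False
  have unit: "is_unit h" if "4 * d = h ^ 2 * E" "E mod 4 \<in> {0, 1}" for h E
  proof (cases "even h")
    case True
    then obtain k where h_eq: "h = 2 * k" by auto
    hence d_eq: "d = k ^ 2 * E" using that(1) by (simp add: power_mult_distrib)
    hence "is_unit k" using assms(1) by (simp add: squarefree_def)
    hence "d = E" using d_eq by (auto simp: zdvd1_eq abs_if power2_eq_1_iff split: if_splits)
    moreover have "\<not> 4 dvd d" using assms(1) squarefreeD[of d 2] by auto
    ultimately have False using that(2) \<open>d mod 4 \<noteq> 1\<close> by auto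
    thus ?thesis ..
  next
    case False
    hence "coprime (h ^ 2) (2 ^ 2)"
      by (simp only: coprime_power_left_iff coprime_power_right_iff) simp
    moreover have "h ^ 2 dvd 2 ^ 2 * d" using that(1) by simp
    ultimately have "h ^ 2 dvd d" by (simp only: coprime_dvd_mult_right_iff)
    thus ?thesis using assms(1) by (simp add: squarefree_def)
  qed
  have "4 * d \<noteq> 1" by presburger
  thus ?thesis
    using unit unfolding fundamental_discriminant_def quad_disc_def if_not_P[OF False] by simp metis
qed

lemma fundamental_discriminant_not_square:
  assumes "fundamental_discriminant D"
  shows "x ^ 2 \<noteq> D"
proof
  assume "x ^ 2 = D"
  hence "D = x ^ 2 * 1" "(1 :: int) mod 4 \<in> {0, 1}" by simp_all
  hence "is_unit x" using assms unfolding fundamental_discriminant_def by metis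
  hence "D = 1" using \<open>x ^ 2 = D\<close> by (auto simp: zdvd1_eq abs_if power2_eq_1_iff split: if_splits)
  thus False using assms by (simp add: fundamental_discriminant_def)
qed

section \<open>Products of additive subgroups of a ring\<close>

context
  fixes S :: "'a::comm_ring_1 set"
begin

private abbreviation (input) prod_on :: "'a set \<Rightarrow> 'a set \<Rightarrow> 'a set" (infixl \<open>\<star>\<close> 70) where
  "I \<star> J \<equiv> ideal_prod (ring_on S) I J"

lemma ideal_prod_mult: "x \<in> I \<Longrightarrow> y \<in> J \<Longrightarrow> x * y \<in> I \<star> J"
  using ideal_prod.prod[of x I y J "ring_on S"] by (simp add: ring_on_def)

lemma ideal_prod_add: "x \<in> I \<star> J \<Longrightarrow> y \<in> I \<star> J \<Longrightarrow> x + y \<in> I \<star> J"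
  using ideal_prod.sum[of x "ring_on S" I J y] by (simp add: ring_on_def)

lemma ideal_prod_induct [consumes 1, case_names mult add]:
  assumes "x \<in> I \<star> J" and "\<And>x y. x \<in> I \<Longrightarrow> y \<in> J \<Longrightarrow> P (x * y)"
    and "\<And>x y. x \<in> I \<star> J \<Longrightarrow> y \<in> I \<star> J \<Longrightarrow> P x \<Longrightarrow> P y \<Longrightarrow> P (x + y)"
  shows "P x"
  using assms(1)
proof (induction rule: ideal_prod.induct)
  case (prod x y)
  thus ?case using assms(2) by (simp add: ring_on_def)
next
  case (sum x y)
  thus ?case using assms(3) by (simp add: ring_on_def)
qed

lemma ideal_prod_subset:
  assumes "\<And>x y. x \<in> I \<Longrightarrow> y \<in> J \<Longrightarrow> x * y \<in> M" and "\<And>x y. x \<in> M \<Longrightarrow> y \<in> M \<Longrightarrow> x + y \<in> M"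
  shows "I \<star> J \<subseteq> M"
proof
  fix x assume "x \<in> I \<star> J"
  thus "x \<in> M" by (induction rule: ideal_prod_induct) (auto intro: assms)
qed

lemma ideal_prod_mono: "I \<subseteq> I' \<Longrightarrow> J \<subseteq> J' \<Longrightarrow> I \<star> J \<subseteq> I' \<star> J'"
  by (rule ideal_prod_subset) (auto intro: ideal_prod_mult ideal_prod_add)

lemma ideal_prod_commute: "I \<star> J = J \<star> I"
proof -
  have "I \<star> J \<subseteq> J \<star> I" for I J
    by (rule ideal_prod_subset)
      (metis ideal_prod_mult mult.commute, rule ideal_prod_add)
  thus ?thesis by blast
qed

lemma ideal_prod_assoc: "(I \<star> J) \<star> L = I \<star> (J \<star> L)"
proof -
  have subset: "(I \<star> J) \<star> L \<subseteq> I \<star> (J \<star> L)" for I J L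
  proof (rule ideal_prod_subset)
    fix x l assume "x \<in> I \<star> J" "l \<in> L"
    thus "x * l \<in> I \<star> (J \<star> L)"
      by (induction rule: ideal_prod_induct)
        (auto simp: mult.assoc distrib_right intro: ideal_prod_mult ideal_prod_add)
  qed (rule ideal_prod_add)
  have "I \<star> (J \<star> L) = (L \<star> J) \<star> I" by (metis ideal_prod_commute)
  also have "\<dots> \<subseteq> L \<star> (J \<star> I)" by (rule subset)
  also have "\<dots> = (I \<star> J) \<star> L" by (metis ideal_prod_commute)
  finally show ?thesis using subset by blast
qed

lemma ideal_prod_left_commute: "I \<star> (J \<star> L) = J \<star> (I \<star> L)"
  by (metis ideal_prod_assoc ideal_prod_commute)

lemmas ideal_prod_ac =
  ideal_prod_assoc ideal_prod_commute ideal_prod_left_commute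

end

section \<open>Groups\<close>

lemma squares_2torsion_subgroup:
  fixes G (structure)
  assumes "comm_group G"
  shows "subgroup (squares_2torsion G) G"
proof -
  interpret comm_group G by (rule assms)
  interpret square: group_hom G G "\<lambda>g. g \<otimes> g"
    by unfold_locales (auto simp: hom_def m_ac)
  have "squares_2torsion G = (\<lambda>g. g \<otimes> g) ` carrier G \<inter> kernel G G (\<lambda>g. g \<otimes> g)"
    by (auto simp: squares_2torsion_def kernel_def)
  thus ?thesis
    using subgroups_Inter_pair[OF square.img_is_subgroup square.subgroup_kernel] by simp
qed

lemma short_exact_kernel:
  assumes "group_hom G H h" "h ` carrier G = carrier H"
  shows "short_exact (G\<lparr>carrier := kernel G H h\<rparr>) G H id h"
proof -
  interpret group_hom G H h by (rule assms)
  have "group (G\<lparr>carrier := kernel G H h\<rparr>)"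
    using subgroup_kernel by (rule subgroup.subgroup_is_group) (rule G.is_group)
  moreover have "id \<in> mon (G\<lparr>carrier := kernel G H h\<rparr>) G"
    by (auto simp: mon_def hom_def kernel_def)
  moreover have "h \<in> epi G H" using homh assms(2) by (simp add: epi_def)
  ultimately show ?thesis by (simp add: short_exact_def)
qed

section \<open>Square classes of rational numbers\<close>

lemma rat_units_simps [simp]:
  "carrier rat_units = - {0}" "x \<otimes>\<^bsub>rat_units\<^esub> y = x * y" "\<one>\<^bsub>rat_units\<^esub> = 1"
  by (simp_all add: rat_units_def)

interpretation rat_units: comm_group rat_units
proof (rule comm_groupI)
  show "\<exists>y\<in>carrier rat_units. y \<otimes>\<^bsub>rat_units\<^esub> x = \<one>\<^bsub>rat_units\<^esub>" if "x \<in> carrier rat_units" for x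
    using that by (intro bexI[of _ "inverse x"]) auto
qed auto

lemma rat_unit_squares_subgroup: "subgroup rat_unit_squares rat_units"
proof -
  interpret group_hom rat_units rat_units "\<lambda>x. x ^ 2"
    by unfold_locales (auto simp: hom_def power_mult_distrib)
  have "rat_unit_squares = (\<lambda>x. x ^ 2) ` carrier rat_units" by (auto simp: rat_unit_squares_def)
  thus ?thesis using img_is_subgroup by simp
qed

interpretation rat_unit_squares: normal rat_unit_squares rat_units
  by (intro rat_units.subgroup_imp_normal rat_unit_squares_subgroup)

abbreviation square_class_group :: "rat set monoid" where
  "square_class_group \<equiv> rat_units Mod rat_unit_squares"

interpretation square_classes: comm_group square_class_group
  by (rule rat_units.abelian_FactGroup[OF rat_unit_squares_subgroup])

lemma square_class_in_carrier: "a > 0 \<Longrightarrow> square_class a \<in> carrier square_class_group"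
  by (auto simp: square_class_def carrier_FactGroup)

lemma square_class_eq_iff:
  assumes "a > 0" "b > 0"
  shows "square_class a = square_class b \<longleftrightarrow> (\<exists>y. of_nat a = y ^ 2 * (of_nat b :: rat))"
proof -
  have "square_class a = square_class b \<longleftrightarrow> of_nat a \<in> square_class b"
    unfolding square_class_def
    using rat_units.repr_independence[OF _ _ rat_unit_squares_subgroup, of "of_nat a" "of_nat b"]
      rat_units.rcos_self[OF _ rat_unit_squares_subgroup, of "of_nat a"] assms by auto
  also have "\<dots> \<longleftrightarrow> (\<exists>y. y \<noteq> 0 \<and> of_nat a = y ^ 2 * (of_nat b :: rat))"
    by (auto simp: square_class_def r_coset_def rat_unit_squares_def)
  also have "\<dots> \<longleftrightarrow> (\<exists>y. of_nat a = y ^ 2 * (of_nat b :: rat))"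
    using assms(1) by (metis mult_zero_left of_nat_0_less_iff order_less_irrefl power_zero_numeral)
  finally show ?thesis .
qed

lemma square_class_one: "square_class 1 = \<one>\<^bsub>square_class_group\<^esub>"
  using rat_units.coset_mult_one[of rat_unit_squares] rat_unit_squares.subset
  by (simp add: square_class_def)

lemma square_class_mult:
  "a > 0 \<Longrightarrow> b > 0 \<Longrightarrow> square_class a \<otimes>\<^bsub>square_class_group\<^esub> square_class b = square_class (a * b)"
  using rat_unit_squares.rcos_sum[of "of_nat a" "of_nat b"] by (simp add: square_class_def)

lemma square_class_mult_square:
  assumes "a > 0" "c > 0"
  shows "square_class (a * c ^ 2) = square_class a"
  using assms by (subst square_class_eq_iff) (auto intro!: exI[of _ "of_nat c"])

lemma square_class_inject:
  assumes "square_class a = square_class b" "squarefree a" "squarefree b"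
  shows "a = b"
proof -
  have pos: "a > 0" "b > 0" using assms(2,3) by (auto intro: gr0I)
  then obtain y where ratio: "of_nat a = y ^ 2 * (of_nat b :: rat)"
    using assms(1) square_class_eq_iff by blast
  obtain m z where denominator: "m > 0" "of_int m * y = of_int z" by (rule rat_denominator)
  have "z \<noteq> 0" using denominator ratio pos by auto
  have "(of_nat (a * nat \<bar>m\<bar> ^ 2) :: rat) = of_nat a * of_int m ^ 2" by simp
  also have "\<dots> = of_nat b * (of_int m * y) ^ 2" unfolding ratio by (simp add: power_mult_distrib)
  also have "\<dots> = of_nat (b * nat \<bar>z\<bar> ^ 2)" unfolding denominator(2) by simp
  finally have "a * nat \<bar>m\<bar> ^ 2 = b * nat \<bar>z\<bar> ^ 2" by (simp only: of_nat_eq_iff)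
  from squarefree_eq_if_square_multiples_eq[OF assms(2,3) _ _ this] show ?thesis
    using denominator(1) \<open>z \<noteq> 0\<close> by simp
qed

section \<open>Quadratic fields\<close>

locale quadratic_field =
  fixes D :: int
  assumes not_square: "\<And>x. x ^ 2 \<noteq> D"
begin

abbreviation K :: "complex set" where "K \<equiv> quad_field D"

abbreviation ring_of_integers :: "complex set" (\<open>\<O>\<close>) where "\<O> \<equiv> quad_ints D"

definition quad :: "rat \<Rightarrow> rat \<Rightarrow> complex" where
  "quad p q = of_rat p + of_rat q * csqrt (of_int D)"

lemma D_nonzero: "D \<noteq> 0"
  using not_square[of 0] by auto

lemma rat_not_square: "x ^ 2 \<noteq> of_int D" for x :: rat
proof
  assume "x ^ 2 = of_int D"
  moreover from this obtain n where "x = of_int n" by (metis rat_square_eq_int_imp_Ints Ints_cases)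
  ultimately have "(of_int (n ^ 2) :: rat) = of_int D" by simp
  thus False using not_square by (simp only: of_int_eq_iff)
qed

lemma quad_add: "quad p q + quad p' q' = quad (p + p') (q + q')"
  and quad_diff: "quad p q - quad p' q' = quad (p - p') (q - q')"
  and quad_minus: "- quad p q = quad (- p) (- q)"
  by (simp_all add: quad_def of_rat_add of_rat_diff of_rat_minus algebra_simps)

lemma quad_mult: "quad p q * quad p' q' = quad (p * p' + of_int D * q * q') (p * q' + q * p')"
proof -
  have "quad p q * quad p' q' = of_rat p * of_rat p' + csqrt (of_int D) ^ 2 * of_rat q * of_rat q' +
          (of_rat p * of_rat q' + of_rat q * of_rat p') * csqrt (of_int D)"
    by (simp only: quad_def power2_eq_square) (simp add: algebra_simps)
  thus ?thesis by (simp add: quad_def of_rat_add of_rat_mult)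
qed

lemma of_rat_eq_quad: "of_rat r = quad r 0"
  and of_int_eq_quad: "of_int n = quad (of_int n) 0"
  and of_nat_eq_quad: "of_nat k = quad (of_nat k) 0"
  and zero_eq_quad: "0 = quad 0 0"
  and one_eq_quad: "1 = quad 1 0"
  by (simp_all add: quad_def)

lemma quad_eq_zero_iff: "quad p q = 0 \<longleftrightarrow> p = 0 \<and> q = 0"
proof
  assume "quad p q = 0"
  hence "quad p q * quad p (- q) = 0" by simp
  hence "of_rat (p ^ 2 - of_int D * q ^ 2) = (0 :: complex)"
    by (simp add: quad_mult of_rat_eq_quad power2_eq_square mult.assoc)
  hence "p ^ 2 - of_int D * q ^ 2 = 0" by (simp only: of_rat_eq_0_iff)
  hence "q \<noteq> 0 \<Longrightarrow> (p / q) ^ 2 = of_int D" by (simp add: power_divide field_simps)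
  hence "q = 0" using rat_not_square by blast
  thus "p = 0 \<and> q = 0" using \<open>quad p q = 0\<close> by (simp add: quad_def)
qed (simp add: quad_def)

lemma quad_inject: "quad p q = quad p' q' \<longleftrightarrow> p = p' \<and> q = q'"
  using quad_eq_zero_iff[of "p - p'" "q - q'"] quad_diff[of p q p' q'] by auto

lemma quad_field_eq: "K = {quad p q | p q. True}"
  unfolding quad_field_def quad_def Rats_def by (auto 0 3)

lemma quad_in_quad_field [simp]: "quad p q \<in> K"
  by (auto simp: quad_field_eq)

lemma quad_field_cases [elim?]:
  assumes "z \<in> K" obtains p q where "z = quad p q"
  using assms by (auto simp: quad_field_eq)

lemma quad_field_add [simp, intro]: "x \<in> K \<Longrightarrow> y \<in> K \<Longrightarrow> x + y \<in> K"
  and quad_field_diff [simp, intro]: "x \<in> K \<Longrightarrow> y \<in> K \<Longrightarrow> x - y \<in> K"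
  and quad_field_mult [simp, intro]: "x \<in> K \<Longrightarrow> y \<in> K \<Longrightarrow> x * y \<in> K"
  by (auto simp: quad_add quad_diff quad_mult elim!: quad_field_cases)

lemma quad_field_of_rat [simp, intro]: "of_rat r \<in> K"
  and quad_field_of_int [simp, intro]: "of_int n \<in> K"
  and quad_field_of_nat [simp, intro]: "of_nat k \<in> K"
  and quad_field_zero [simp, intro]: "0 \<in> K"
  and quad_field_one [simp, intro]: "1 \<in> K"
  by (simp_all only: of_rat_eq_quad of_int_eq_quad of_nat_eq_quad zero_eq_quad one_eq_quad
      quad_in_quad_field)

lemma quad_field_power [simp, intro]: "x \<in> K \<Longrightarrow> x ^ n \<in> K"
  by (induction n) auto

definition rat_part :: "complex \<Rightarrow> rat" where "rat_part z = (THE p. \<exists>q. z = quad p q)"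
definition sqrt_part :: "complex \<Rightarrow> rat" where "sqrt_part z = (THE q. \<exists>p. z = quad p q)"
definition conjugate :: "complex \<Rightarrow> complex" where "conjugate z = quad (rat_part z) (- sqrt_part z)"
definition Nm :: "complex \<Rightarrow> rat" where "Nm z = rat_part z ^ 2 - of_int D * sqrt_part z ^ 2"
definition Tr :: "complex \<Rightarrow> rat" where "Tr z = 2 * rat_part z"

lemma rat_part_quad [simp]: "rat_part (quad p q) = p"
  and sqrt_part_quad [simp]: "sqrt_part (quad p q) = q"
  by (auto simp: rat_part_def sqrt_part_def quad_inject)

lemma conjugate_quad [simp]: "conjugate (quad p q) = quad p (- q)"
  and Nm_quad [simp]: "Nm (quad p q) = p ^ 2 - of_int D * q ^ 2"
  and Tr_quad [simp]: "Tr (quad p q) = 2 * p"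
  by (simp_all add: conjugate_def Nm_def Tr_def)

lemma quad_field_conjugate [simp, intro]: "conjugate x \<in> K"
  by (simp add: conjugate_def)

lemma conjugate_conjugate [simp]: "x \<in> K \<Longrightarrow> conjugate (conjugate x) = x"
  by (auto elim!: quad_field_cases)

lemma conjugate_add: "x \<in> K \<Longrightarrow> y \<in> K \<Longrightarrow> conjugate (x + y) = conjugate x + conjugate y"
  and conjugate_mult: "x \<in> K \<Longrightarrow> y \<in> K \<Longrightarrow> conjugate (x * y) = conjugate x * conjugate y"
  by (auto simp: quad_add quad_mult elim!: quad_field_cases)

lemma conjugate_of_rat [simp]: "conjugate (of_rat r) = of_rat r"
  and conjugate_of_int [simp]: "conjugate (of_int n) = of_int n"
  and conjugate_zero [simp]: "conjugate 0 = 0"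
  and conjugate_one [simp]: "conjugate 1 = 1"
  by (simp_all add: of_rat_eq_quad of_int_eq_quad zero_eq_quad one_eq_quad)

lemma conjugate_eq_zero_iff [simp]: "x \<in> K \<Longrightarrow> conjugate x = 0 \<longleftrightarrow> x = 0"
  by (metis conjugate_zero conjugate_conjugate)

lemma mult_conjugate: "x \<in> K \<Longrightarrow> x * conjugate x = of_rat (Nm x)"
  and add_conjugate: "x \<in> K \<Longrightarrow> x + conjugate x = of_rat (Tr x)"
  by (auto simp: of_rat_eq_quad quad_mult quad_add power2_eq_square mult.assoc elim!: quad_field_cases)

lemma Nm_of_rat [simp]: "Nm (of_rat r) = r ^ 2"
  and Nm_of_int [simp]: "Nm (of_int n) = of_int n ^ 2"
  and Nm_zero [simp]: "Nm 0 = 0"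
  and Nm_one [simp]: "Nm 1 = 1"
  by (simp_all add: of_rat_eq_quad of_int_eq_quad zero_eq_quad one_eq_quad)

lemma Nm_minus [simp]: "x \<in> K \<Longrightarrow> Nm (- x) = Nm x"
  and Nm_mult: "x \<in> K \<Longrightarrow> y \<in> K \<Longrightarrow> Nm (x * y) = Nm x * Nm y"
  and Nm_add: "x \<in> K \<Longrightarrow> y \<in> K \<Longrightarrow> Nm (x + y) = Nm x + Nm y + Tr (x * conjugate y)"
  by (auto simp: quad_minus quad_add quad_mult power2_eq_square algebra_simps elim!: quad_field_cases)

lemma Nm_power: "x \<in> K \<Longrightarrow> Nm (x ^ n) = Nm x ^ n"
  by (induction n) (auto simp: Nm_mult)

lemma Nm_conjugate [simp]: "x \<in> K \<Longrightarrow> Nm (conjugate x) = Nm x"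
  and Tr_conjugate [simp]: "x \<in> K \<Longrightarrow> Tr (conjugate x) = Tr x"
  by (auto elim!: quad_field_cases)

lemma Tr_add: "x \<in> K \<Longrightarrow> y \<in> K \<Longrightarrow> Tr (x + y) = Tr x + Tr y"
  and Tr_of_rat_mult: "x \<in> K \<Longrightarrow> Tr (of_rat r * x) = r * Tr x"
  by (auto simp: of_rat_eq_quad quad_add quad_mult elim!: quad_field_cases)

lemma Tr_one [simp]: "Tr 1 = 2"
  by (simp add: one_eq_quad)

lemma Nm_eq_zero_iff: "x \<in> K \<Longrightarrow> Nm x = 0 \<longleftrightarrow> x = 0"
  by (metis Nm_zero conjugate_eq_zero_iff mult_conjugate mult_eq_0_iff of_rat_0)

lemma inverse_eq_conjugate: "x \<in> K \<Longrightarrow> x \<noteq> 0 \<Longrightarrow> inverse x = of_rat (inverse (Nm x)) * conjugate x"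
  using mult_conjugate[of x] Nm_eq_zero_iff[of x]
  by (intro inverse_unique) (simp add: mult.left_commute[of x] flip: of_rat_mult)

lemma quad_field_inverse [simp, intro]: "x \<in> K \<Longrightarrow> inverse x \<in> K"
  by (cases "x = 0") (auto simp: inverse_eq_conjugate)

lemma Nm_inverse: "x \<in> K \<Longrightarrow> Nm (inverse x) = inverse (Nm x)"
  by (cases "x = 0") (auto intro: inverse_unique[symmetric] simp flip: Nm_mult)

lemma quadratic_equation: "x \<in> K \<Longrightarrow> x * x = of_rat (Tr x) * x - of_rat (Nm x)"
  by (simp add: algebra_simps flip: mult_conjugate add_conjugate)

lemma quad_conj_eq_image:
  assumes "S \<subseteq> K"
  shows "quad_conj D S = conjugate ` S"
proof -
  have "quad_conj D S = {quad p (- q) | p q. quad p q \<in> S}"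
    unfolding quad_conj_def quad_def Rats_def by (auto simp: of_rat_minus)
  also have "\<dots> = conjugate ` S"
    using assms by (force simp: image_iff elim: quad_field_cases)
  finally show ?thesis .
qed

section \<open>The ring of integers\<close>

definition quad_order :: "complex set" where
  "quad_order = {quad (of_int i) (of_int j) | i j. True}"

lemma quad_order_cases [elim?]:
  assumes "z \<in> quad_order" obtains i j where "z = quad (of_int i) (of_int j)"
  using assms by (auto simp: quad_order_def)

lemma quad_in_quad_order [simp]: "quad (of_int i) (of_int j) \<in> quad_order"
  by (auto simp: quad_order_def)

lemma quad_order_of_int [simp]: "of_int n \<in> quad_order"
  unfolding of_int_eq_quad using quad_in_quad_order[of n 0] by simp

lemma quad_order_add: "x \<in> quad_order \<Longrightarrow> y \<in> quad_order \<Longrightarrow> x + y \<in> quad_order"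
  by (auto simp: quad_add simp flip: of_int_add elim!: quad_order_cases)

lemma quad_order_mult: "x \<in> quad_order \<Longrightarrow> y \<in> quad_order \<Longrightarrow> x * y \<in> quad_order"
  by (auto simp: quad_mult simp flip: of_int_add of_int_mult elim!: quad_order_cases)

lemma quad_order_sum: "(\<And>i. i \<in> A \<Longrightarrow> f i \<in> quad_order) \<Longrightarrow> sum f A \<in> quad_order"
  using quad_order_of_int[of 0]
  by (induction A rule: infinite_finite_induct) (auto intro: quad_order_add)

lemma quad_order_Nm: "x \<in> quad_order \<Longrightarrow> Nm x \<in> \<int>"
  by (auto elim!: quad_order_cases)

lemma quad_field_denominator:
  assumes "z \<in> K"
  obtains m where "m > 0" "of_int m * z \<in> quad_order"
proof -
  obtain p q where z_eq: "z = quad p q" using assms by (rule quad_field_cases)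
  obtain m i where denominator_p: "m > 0" "of_int m * p = of_int i" by (rule rat_denominator)
  obtain n j where denominator_q: "n > 0" "of_int n * q = of_int j" by (rule rat_denominator)
  have "of_int (m * n) * z = quad (of_int n * (of_int m * p)) (of_int m * (of_int n * q))"
    by (simp add: z_eq of_int_eq_quad quad_mult mult_ac)
  also have "\<dots> = quad (of_int (n * i)) (of_int (m * j))"
    by (simp only: denominator_p denominator_q of_int_mult)
  finally have "of_int (m * n) * z \<in> quad_order" by (simp only: quad_in_quad_order)
  thus thesis using that[of "m * n"] denominator_p(1) denominator_q(1) by simp
qed

lemma quad_field_common_denominator:
  assumes "finite A" "A \<subseteq> K"
  obtains m where "m > 0" "\<And>z. z \<in> A \<Longrightarrow> of_int m * z \<in> quad_order"
proof -
  have "\<exists>m>0. \<forall>z\<in>A. of_int m * z \<in> quad_order"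
    using assms
  proof (induction A rule: finite_induct)
    case (insert x A)
    then obtain m where denominator_A: "m > 0" "\<forall>z\<in>A. of_int m * z \<in> quad_order" by auto
    obtain n where denominator_x: "n > 0" "of_int n * x \<in> quad_order"
      using insert.prems by (auto intro: quad_field_denominator[of x])
    have "of_int (m * n) * z \<in> quad_order" if "z \<in> insert x A" for z
    proof (cases "z = x")
      case True
      thus ?thesis
        using quad_order_mult[OF quad_order_of_int denominator_x(2), of m] by (simp add: mult.assoc)
    next
      case False
      hence "of_int m * z \<in> quad_order" using that denominator_A(2) by blast
      from quad_order_mult[OF quad_order_of_int this, of n] show ?thesis by (simp add: ac_simps)
    qed
    thus ?case using denominator_A(1) denominator_x(1) by (intro exI[of _ "m * n"]) auto
  qed (auto intro: exI[of _ 1])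
  thus thesis using that by blast
qed

text \<open>Integrality in \<open>K\<close> is the boundedness of the denominators of all powers, a condition which is
  visibly stable under sums and products.\<close>

definition powers_bounded :: "complex \<Rightarrow> bool" where
  "powers_bounded z \<longleftrightarrow> (\<exists>m>0. \<forall>k. of_int m * z ^ k \<in> quad_order)"

lemma powers_bounded_of_int: "powers_bounded (of_int n)"
  unfolding powers_bounded_def using quad_order_of_int
  by (intro exI[of _ 1]) (simp flip: of_int_power)

lemma powers_bounded_mult:
  assumes "powers_bounded x" "powers_bounded y"
  shows "powers_bounded (x * y)"
proof -
  obtain m n where denominators: "m > 0" "n > 0"
      "\<And>k. of_int m * x ^ k \<in> quad_order" "\<And>k. of_int n * y ^ k \<in> quad_order"
    using assms unfolding powers_bounded_def by blast
  have "of_int (m * n) * (x * y) ^ k = (of_int m * x ^ k) * (of_int n * y ^ k)" for k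
    by (simp add: power_mult_distrib)
  thus ?thesis unfolding powers_bounded_def using denominators
    by (intro exI[of _ "m * n"]) (simp add: quad_order_mult del: of_int_mult)
qed

lemma powers_bounded_add:
  assumes "powers_bounded x" "powers_bounded y"
  shows "powers_bounded (x + y)"
proof -
  obtain m n where denominators: "m > 0" "n > 0"
      "\<And>k. of_int m * x ^ k \<in> quad_order" "\<And>k. of_int n * y ^ k \<in> quad_order"
    using assms unfolding powers_bounded_def by blast
  have "of_int (m * n) * (x + y) ^ k \<in> quad_order" for k
  proof -
    have "of_int (m * n) * (x + y) ^ k =
        (\<Sum>i\<le>k. of_int (int (k choose i)) * ((of_int m * x ^ i) * (of_int n * y ^ (k - i))))"
      by (simp add: binomial_ring sum_distrib_left mult_ac)
    also have "\<dots> \<in> quad_order"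
      by (intro quad_order_sum quad_order_mult quad_order_of_int denominators)
    finally show ?thesis .
  qed
  thus ?thesis
    unfolding powers_bounded_def using denominators(1,2) by (intro exI[of _ "m * n"]) simp
qed

lemma powers_bounded_Nm:
  assumes "z \<in> K" "powers_bounded z"
  shows "Nm z \<in> \<int>"
proof -
  obtain m where denominator: "m > 0" "\<And>k. of_int m * z ^ k \<in> quad_order"
    using assms(2) unfolding powers_bounded_def by blast
  show ?thesis
  proof (rule Ints_if_powers_common_denominator)
    show "m ^ 2 > 0" using denominator(1) by simp
    show "of_int (m ^ 2) * Nm z ^ k \<in> \<int>" for k
      using quad_order_Nm[OF denominator(2)[of k]] assms(1) by (simp add: Nm_mult Nm_power)
  qed
qed

lemma powers_bounded_Tr:
  assumes "z \<in> K" "powers_bounded z"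
  shows "Tr z \<in> \<int>"
proof -
  have "Tr z = Nm (z + 1) - Nm z - 1"
    using assms(1) by (simp add: Nm_add)
  moreover have "Nm (z + 1) \<in> \<int>"
    using powers_bounded_Nm[OF _ powers_bounded_add[OF assms(2) powers_bounded_of_int[of 1]]] assms(1)
    by simp
  ultimately show ?thesis using powers_bounded_Nm[OF assms] by simp
qed

lemma algebraic_int_imp_powers_bounded:
  assumes "z \<in> K" "algebraic_int z"
  shows "powers_bounded z"
proof -
  obtain p where monic_root: "Polynomial.lead_coeff p = 1" "\<forall>i. Polynomial.coeff p i \<in> \<int>" "poly p z = 0"
    using assms(2) by (auto elim: algebraic_int.cases)
  define n where "n = Polynomial.degree p"
  have "0 = (\<Sum>i\<le>n. Polynomial.coeff p i * z ^ i)"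
    using monic_root(3) by (simp add: poly_altdef n_def)
  also have "\<dots> = z ^ n + (\<Sum>i<n. Polynomial.coeff p i * z ^ i)"
    using monic_root(1) by (simp add: n_def flip: lessThan_Suc_atMost)
  finally have z_power_n: "z ^ n = - (\<Sum>i<n. Polynomial.coeff p i * z ^ i)"
    by (simp add: eq_neg_iff_add_eq_0)
  have "finite ((\<lambda>k. z ^ k) ` {..<n})" "(\<lambda>k. z ^ k) ` {..<n} \<subseteq> K" using assms(1) by auto
  then obtain m where denominator: "m > 0" "\<And>x. x \<in> (\<lambda>k. z ^ k) ` {..<n} \<Longrightarrow> of_int m * x \<in> quad_order"
    using quad_field_common_denominator by metis
  have "of_int m * z ^ k \<in> quad_order" for k
  proof (induction k rule: less_induct)
    case (less k)
    show ?case
    proof (cases "k < n")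
      case False
      hence "z ^ k = z ^ (k - n) * z ^ n" by (simp flip: power_add)
      hence "of_int m * z ^ k = (\<Sum>i<n. (- Polynomial.coeff p i) * (of_int m * z ^ (k - n + i)))"
        unfolding z_power_n by (simp add: sum_distrib_left sum_negf power_add mult_ac)
      also have "\<dots> \<in> quad_order"
      proof (rule quad_order_sum)
        fix i assume "i \<in> {..<n}"
        hence "of_int m * z ^ (k - n + i) \<in> quad_order" using False by (intro less) auto
        moreover have "- Polynomial.coeff p i \<in> \<int>" using monic_root(2) by simp
        hence "- Polynomial.coeff p i \<in> quad_order" by (metis Ints_cases quad_order_of_int)
        ultimately show "- Polynomial.coeff p i * (of_int m * z ^ (k - n + i)) \<in> quad_order"
          by (rule quad_order_mult[rotated])
      qed
      finally show ?thesis .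
    qed (use denominator(2) in auto)
  qed
  thus ?thesis using denominator(1) by (auto simp: powers_bounded_def)
qed

lemma Tr_Nm_Ints_imp_algebraic_int:
  assumes "z \<in> K" "Tr z \<in> \<int>" "Nm z \<in> \<int>"
  shows "algebraic_int z"
proof -
  obtain t n where integral: "Tr z = of_int t" "Nm z = of_int n"
    using assms(2,3) by (metis Ints_cases)
  show ?thesis
  proof (rule algebraic_int.intros)
    show "Polynomial.lead_coeff [:of_int n, - of_int t, 1 :: complex:] = 1" by simp
    show "\<forall>i. Polynomial.coeff [:of_int n, - of_int t, 1 :: complex:] i \<in> \<int>"
      by (auto simp: coeff_pCons split: nat.splits)
    show "poly [:of_int n, - of_int t, 1:] z = 0"
      using quadratic_equation[OF assms(1)] integral by (simp add: algebra_simps)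
  qed
qed

lemma quad_ints_iff_powers_bounded: "z \<in> \<O> \<longleftrightarrow> z \<in> K \<and> powers_bounded z"
  and quad_ints_iff_Tr_Nm: "z \<in> \<O> \<longleftrightarrow> z \<in> K \<and> Tr z \<in> \<int> \<and> Nm z \<in> \<int>"
  unfolding quad_ints_def mem_Collect_eq
  by (metis algebraic_int_imp_powers_bounded powers_bounded_Tr powers_bounded_Nm
      Tr_Nm_Ints_imp_algebraic_int)+

lemma quad_ints_subset_quad_field: "\<O> \<subseteq> K"
  by (auto simp: quad_ints_def)

lemma quad_ints_in_quad_field [simp, intro]: "x \<in> \<O> \<Longrightarrow> x \<in> K"
  using quad_ints_subset_quad_field by blast

lemma quad_ints_add [simp, intro]: "x \<in> \<O> \<Longrightarrow> y \<in> \<O> \<Longrightarrow> x + y \<in> \<O>"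
  and quad_ints_mult [simp, intro]: "x \<in> \<O> \<Longrightarrow> y \<in> \<O> \<Longrightarrow> x * y \<in> \<O>"
  and quad_ints_of_int [simp, intro]: "of_int n \<in> \<O>"
  by (simp_all add: quad_ints_iff_powers_bounded powers_bounded_add powers_bounded_mult
      powers_bounded_of_int)

lemma quad_ints_zero [simp, intro]: "0 \<in> \<O>"
  and quad_ints_one [simp, intro]: "1 \<in> \<O>"
  using quad_ints_of_int[of 0] quad_ints_of_int[of 1] by simp_all

lemma quad_ints_minus [simp, intro]: "x \<in> \<O> \<Longrightarrow> - x \<in> \<O>"
  using quad_ints_mult[of "- 1" x] quad_ints_of_int[of "- 1"] by simp

lemma quad_ints_conjugate [simp, intro]: "x \<in> \<O> \<Longrightarrow> conjugate x \<in> \<O>"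
  by (simp add: quad_ints_iff_Tr_Nm)

lemma conjugate_image_quad_ints: "conjugate ` \<O> = \<O>"
proof
  show "\<O> \<subseteq> conjugate ` \<O>"
    by (metis conjugate_conjugate image_eqI quad_ints_conjugate quad_ints_in_quad_field subsetI)
qed auto

lemma of_rat_in_quad_ints_iff: "of_rat r \<in> \<O> \<longleftrightarrow> r \<in> \<int>"
proof
  assume "of_rat r \<in> \<O>"
  hence "algebraic_int (of_rat r :: complex)" unfolding quad_ints_def by blast
  hence "(of_rat r :: complex) \<in> \<int>" by (rule rational_algebraic_int_is_int) (rule Rats_of_rat)
  thus "r \<in> \<int>" by (metis Ints_cases Ints_of_int of_rat_eq_iff of_rat_of_int_eq)
qed (auto elim!: Ints_cases)

lemma quad_ints_Nm_cases:
  assumes "x \<in> \<O>" obtains n where "Nm x = of_int n"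
  using assms by (auto simp: quad_ints_iff_Tr_Nm elim!: Ints_cases)

lemma quad_order_subset_quad_ints: "quad_order \<subseteq> \<O>"
  by (auto simp: quad_ints_iff_Tr_Nm elim!: quad_order_cases)

section \<open>Fractional ideals\<close>

abbreviation frac_ideal :: "complex set \<Rightarrow> bool" where "frac_ideal \<equiv> fractional_ideal D"

abbreviation frac_ideal_prod :: "complex set \<Rightarrow> complex set \<Rightarrow> complex set" (infixl \<open>\<star>\<close> 70) where
  "I \<star> J \<equiv> ideal_prod (ring_on K) I J"

lemma frac_ideal_subset: "frac_ideal J \<Longrightarrow> J \<subseteq> K"
  and frac_ideal_zero: "frac_ideal J \<Longrightarrow> 0 \<in> J"
  and frac_ideal_add: "frac_ideal J \<Longrightarrow> x \<in> J \<Longrightarrow> y \<in> J \<Longrightarrow> x + y \<in> J"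
  and frac_ideal_mult: "frac_ideal J \<Longrightarrow> c \<in> \<O> \<Longrightarrow> x \<in> J \<Longrightarrow> c * x \<in> J"
  by (auto simp: fractional_ideal_def)

lemma frac_ideal_in_quad_field: "frac_ideal J \<Longrightarrow> x \<in> J \<Longrightarrow> x \<in> K"
  using frac_ideal_subset by blast

lemma frac_ideal_minus: "frac_ideal J \<Longrightarrow> x \<in> J \<Longrightarrow> - x \<in> J"
  using frac_ideal_mult[of J "- 1" x] by simp

lemma frac_ideal_diff: "frac_ideal J \<Longrightarrow> x \<in> J \<Longrightarrow> y \<in> J \<Longrightarrow> x - y \<in> J"
  using frac_ideal_add[of J x "- y"] frac_ideal_minus by simp

lemma frac_ideal_of_int_gcd:
  assumes frac_J: "frac_ideal J" and "of_int b \<in> J" "of_int c \<in> J"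
  shows "of_int (gcd b c) \<in> J"
proof -
  obtain u v where "u * b + v * c = gcd b c" using bezout_int by blast
  hence "of_int (gcd b c) = of_int u * of_int b + (of_int v * of_int c :: complex)"
    by (simp flip: of_int_mult of_int_add)
  thus ?thesis using assms frac_ideal_add[OF frac_J] frac_ideal_mult[OF frac_J] by simp
qed

lemma frac_ideal_nonzero:
  assumes "frac_ideal J" obtains x where "x \<in> J" "x \<noteq> 0"
  using assms by (auto simp: fractional_ideal_def)

lemma frac_ideal_denominator:
  assumes "frac_ideal J"
  obtains m where "m > 0" "\<And>x. x \<in> J \<Longrightarrow> of_int m * x \<in> \<O>"
proof -
  obtain c where denominator: "c \<in> \<O>" "c \<noteq> 0" "\<And>x. x \<in> J \<Longrightarrow> c * x \<in> \<O>"
    using assms unfolding fractional_ideal_def by blast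
  obtain n where Nm_c: "Nm c = of_int n" using denominator(1) by (rule quad_ints_Nm_cases)
  have "n \<noteq> 0" using denominator Nm_eq_zero_iff[of c] Nm_c by auto
  have "of_int n * x \<in> \<O>" if "x \<in> J" for x
  proof -
    have product_eq: "of_int n * x = conjugate c * (c * x)"
      using mult_conjugate[of c] denominator(1) Nm_c by (simp add: mult_ac flip: mult.assoc)
    show ?thesis unfolding product_eq using denominator(1) denominator(3)[OF that] by blast
  qed
  hence "of_int \<bar>n\<bar> * x \<in> \<O>" if "x \<in> J" for x
    using that quad_ints_minus[of "of_int n * x"] by (cases "n \<ge> 0") auto
  thus thesis using that[of "\<bar>n\<bar>"] \<open>n \<noteq> 0\<close> by simp
qed

lemma frac_idealI:
  assumes "J \<subseteq> K" "\<And>x y. x \<in> J \<Longrightarrow> y \<in> J \<Longrightarrow> x + y \<in> J"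
    "\<And>c x. c \<in> \<O> \<Longrightarrow> x \<in> J \<Longrightarrow> c * x \<in> J" "\<exists>x\<in>J. x \<noteq> 0"
    "m > 0" "\<And>x. x \<in> J \<Longrightarrow> of_int m * x \<in> \<O>"
  shows "frac_ideal J"
  unfolding fractional_ideal_def
proof (intro conjI ballI)
  show "0 \<in> J" using assms(3)[of 0] assms(4) by auto
  show "\<exists>c\<in>\<O>. c \<noteq> 0 \<and> (\<forall>x\<in>J. c * x \<in> \<O>)"
    using assms(5,6) by (intro bexI[of _ "of_int m"]) auto
qed (use assms in auto)

lemma frac_ideal_prod [simp, intro]:
  assumes "frac_ideal I" "frac_ideal J"
  shows "frac_ideal (I \<star> J)"
proof -
  obtain m where denominator_I: "m > 0" "\<And>x. x \<in> I \<Longrightarrow> of_int m * x \<in> \<O>"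
    using frac_ideal_denominator[OF assms(1)] by blast
  obtain n where denominator_J: "n > 0" "\<And>x. x \<in> J \<Longrightarrow> of_int n * x \<in> \<O>"
    using frac_ideal_denominator[OF assms(2)] by blast
  show ?thesis
  proof (rule frac_idealI)
    show "I \<star> J \<subseteq> K"
      by (rule ideal_prod_subset) (auto intro: assms frac_ideal_in_quad_field)
    show "c * x \<in> I \<star> J" if "c \<in> \<O>" "x \<in> I \<star> J" for c x
      using that(2)
    proof (induction rule: ideal_prod_induct)
      case (mult x y)
      have "c * x * y \<in> I \<star> J"
        using mult frac_ideal_mult[OF assms(1) that(1)] by (intro ideal_prod_mult)
      thus ?case by (simp add: mult.assoc)
    qed (simp add: distrib_left ideal_prod_add)
    obtain x y where "x \<in> I" "x \<noteq> 0" "y \<in> J" "y \<noteq> 0"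
      using assms by (metis frac_ideal_nonzero)
    thus "\<exists>x\<in>I \<star> J. x \<noteq> 0" by (intro bexI[of _ "x * y"]) (auto intro: ideal_prod_mult)
    show "m * n > 0" using denominator_I denominator_J by simp
    show "of_int (m * n) * x \<in> \<O>" if "x \<in> I \<star> J" for x
      using that
    proof (induction rule: ideal_prod_induct)
      case (mult x y)
      have "of_int (m * n) * (x * y) = (of_int m * x) * (of_int n * y)" by simp
      thus ?case using denominator_I(2) denominator_J(2) mult by (simp only:) (rule quad_ints_mult)
    qed (simp add: distrib_left)
  qed (rule ideal_prod_add)
qed

lemma frac_ideal_conjugate [simp, intro]:
  assumes "frac_ideal J"
  shows "frac_ideal (conjugate ` J)"
proof -
  have J_in_K: "x \<in> K" if "x \<in> J" for x using assms that by (rule frac_ideal_in_quad_field)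
  obtain m where denominator: "m > 0" "\<And>x. x \<in> J \<Longrightarrow> of_int m * x \<in> \<O>"
    using frac_ideal_denominator[OF assms] by blast
  show ?thesis
  proof (rule frac_idealI)
    show "x + y \<in> conjugate ` J" if "x \<in> conjugate ` J" "y \<in> conjugate ` J" for x y
      using that frac_ideal_add[OF assms] by (auto simp: J_in_K simp flip: conjugate_add)
    show "c * x \<in> conjugate ` J" if integral: "c \<in> \<O>" and in_image: "x \<in> conjugate ` J" for c x
    proof -
      obtain y where preimage: "y \<in> J" "x = conjugate y" using in_image by blast
      have "c * x = conjugate (conjugate c * y)"
        using preimage integral by (simp add: conjugate_mult J_in_K)
      thus ?thesis using frac_ideal_mult[OF assms] preimage integral by auto
    qed
    show "\<exists>x\<in>conjugate ` J. x \<noteq> 0" using assms J_in_K by (auto elim!: frac_ideal_nonzero)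
    show "of_int m * x \<in> \<O>" if in_image: "x \<in> conjugate ` J" for x
    proof -
      obtain y where preimage: "y \<in> J" "x = conjugate y" using in_image by blast
      hence "of_int m * x = conjugate (of_int m * y)" by (simp add: conjugate_mult J_in_K)
      thus ?thesis using denominator(2) preimage by auto
    qed
  qed (use denominator(1) in auto)
qed

lemma conjugate_image_image: "I \<subseteq> K \<Longrightarrow> conjugate ` conjugate ` I = I"
  by (force simp: image_image)

lemma conjugate_image_prod:
  assumes "I \<subseteq> K" "J \<subseteq> K"
  shows "conjugate ` (I \<star> J) = conjugate ` I \<star> conjugate ` J"
proof
  have subset: "conjugate ` (I \<star> J) \<subseteq> conjugate ` I \<star> conjugate ` J" if "I \<subseteq> K" "J \<subseteq> K" for I J
  proof -
    have "x \<in> K \<and> conjugate x \<in> conjugate ` I \<star> conjugate ` J" if "x \<in> I \<star> J" for x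
      using that
    proof (induction rule: ideal_prod_induct)
      case (mult x y)
      hence "x \<in> K" "y \<in> K" using \<open>I \<subseteq> K\<close> \<open>J \<subseteq> K\<close> by auto
      thus ?case using mult by (auto simp: conjugate_mult intro: ideal_prod_mult)
    qed (auto simp: conjugate_add intro: ideal_prod_add)
    thus ?thesis by auto
  qed
  show "conjugate ` (I \<star> J) \<subseteq> conjugate ` I \<star> conjugate ` J" using assms by (rule subset)
  have "conjugate ` I \<star> conjugate ` J \<subseteq> K" by (rule ideal_prod_subset) auto
  hence "conjugate ` I \<star> conjugate ` J = conjugate ` conjugate ` (conjugate ` I \<star> conjugate ` J)"
    by (simp only: conjugate_image_image)
  also have "\<dots> \<subseteq> conjugate ` (conjugate ` conjugate ` I \<star> conjugate ` conjugate ` J)"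
    by (intro image_mono subset) auto
  also have "\<dots> = conjugate ` (I \<star> J)" using assms by (simp add: conjugate_image_image)
  finally show "conjugate ` I \<star> conjugate ` J \<subseteq> conjugate ` (I \<star> J)" .
qed

definition principal_ideal :: "complex \<Rightarrow> complex set" where
  "principal_ideal x = (\<lambda>y. x * y) ` \<O>"

lemma principal_ideal_self [simp, intro]: "x \<in> principal_ideal x"
  by (auto simp: principal_ideal_def intro: image_eqI[of _ _ 1])

lemma principal_ideal_one: "principal_ideal 1 = \<O>"
  by (simp add: principal_ideal_def)

lemma principal_ideal_minus: "principal_ideal (- x) = principal_ideal x"
proof -
  have "principal_ideal (- x) \<subseteq> principal_ideal x" for x
    by (auto simp: principal_ideal_def image_iff intro!: bexI[of _ "- _"])
  from this[of x] this[of "- x"] show ?thesis by simp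
qed

lemma frac_ideal_principal_ideal [simp, intro]:
  assumes "x \<in> K" "x \<noteq> 0"
  shows "frac_ideal (principal_ideal x)"
proof -
  obtain m where denominator: "m > 0" "of_int m * x \<in> quad_order"
    using assms(1) by (rule quad_field_denominator)
  show ?thesis
  proof (rule frac_idealI)
    show "principal_ideal x \<subseteq> K" using assms by (auto simp: principal_ideal_def)
    show "\<exists>y\<in>principal_ideal x. y \<noteq> 0" using assms(2) by blast
    show "y + z \<in> principal_ideal x" if "y \<in> principal_ideal x" "z \<in> principal_ideal x" for y z
      using that by (auto simp: principal_ideal_def simp flip: distrib_left)
    show "c * y \<in> principal_ideal x" if "c \<in> \<O>" "y \<in> principal_ideal x" for c y
      using that by (auto simp: principal_ideal_def mult.left_commute)
    show "of_int m * y \<in> \<O>" if "y \<in> principal_ideal x" for y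
      using that denominator(2) quad_order_subset_quad_ints
      by (auto simp: principal_ideal_def simp flip: mult.assoc)
  qed (rule denominator)
qed

lemma frac_ideal_quad_ints [simp, intro]: "frac_ideal \<O>"
  using frac_ideal_principal_ideal[of 1] by (simp add: principal_ideal_one)

lemma principal_ideal_subset_iff: "frac_ideal J \<Longrightarrow> principal_ideal x \<subseteq> J \<longleftrightarrow> x \<in> J"
  using frac_ideal_mult[of J _ x] principal_ideal_self[of x]
  by (auto simp: principal_ideal_def mult.commute[of x])

lemma principal_ideal_prod:
  assumes "frac_ideal J"
  shows "principal_ideal x \<star> J = (\<lambda>y. x * y) ` J"
proof
  show "principal_ideal x \<star> J \<subseteq> (\<lambda>y. x * y) ` J"
  proof (rule ideal_prod_subset)
    show "y * z \<in> (\<lambda>y. x * y) ` J" if "y \<in> principal_ideal x" "z \<in> J" for y z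
      using that frac_ideal_mult[OF assms] by (auto simp: principal_ideal_def mult.assoc)
    show "y + z \<in> (\<lambda>y. x * y) ` J" if "y \<in> (\<lambda>y. x * y) ` J" "z \<in> (\<lambda>y. x * y) ` J" for y z
      using that frac_ideal_add[OF assms] by (auto simp flip: distrib_left)
  qed
  show "(\<lambda>y. x * y) ` J \<subseteq> principal_ideal x \<star> J" by (auto intro: ideal_prod_mult)
qed

lemma principal_ideal_prod_principal:
  assumes "y \<in> K" "y \<noteq> 0"
  shows "principal_ideal x \<star> principal_ideal y = principal_ideal (x * y)"
  unfolding principal_ideal_prod[OF frac_ideal_principal_ideal[OF assms]]
  by (simp add: principal_ideal_def image_image mult.assoc)

lemma quad_ints_ideal_prod [simp]: "frac_ideal J \<Longrightarrow> \<O> \<star> J = J"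
  and ideal_prod_quad_ints [simp]: "frac_ideal J \<Longrightarrow> J \<star> \<O> = J"
  using principal_ideal_prod[of J 1] ideal_prod_commute[of K J \<O>]
  by (simp_all add: principal_ideal_one)

lemma conjugate_image_principal_ideal:
  assumes "x \<in> K"
  shows "conjugate ` principal_ideal x = principal_ideal (conjugate x)"
proof -
  have "conjugate ` principal_ideal x = (\<lambda>y. conjugate x * conjugate y) ` \<O>"
    unfolding principal_ideal_def image_image
    by (intro image_cong) (auto simp: conjugate_mult assms)
  also have "\<dots> = (\<lambda>y. conjugate x * y) ` conjugate ` \<O>" by (simp add: image_image)
  finally show ?thesis by (simp add: principal_ideal_def conjugate_image_quad_ints)
qed

lemma mem_principal_ideal_iff_divide: "x \<noteq> 0 \<Longrightarrow> z \<in> principal_ideal x \<longleftrightarrow> z / x \<in> \<O>"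
  by (auto simp: principal_ideal_def image_iff intro: bexI[of _ "z / x"])

lemma mem_principal_ideal_of_rat_iff:
  assumes "z \<in> K" "g \<noteq> 0"
  shows "z \<in> principal_ideal (of_rat g) \<longleftrightarrow> Tr z / g \<in> \<int> \<and> Nm z / g ^ 2 \<in> \<int>"
proof -
  have "z \<in> principal_ideal (of_rat g) \<longleftrightarrow> of_rat (inverse g) * z \<in> \<O>"
    using assms(2)
    by (simp add: mem_principal_ideal_iff_divide of_rat_inverse divide_inverse mult.commute)
  also have "\<dots> \<longleftrightarrow> Tr z / g \<in> \<int> \<and> Nm z / g ^ 2 \<in> \<int>"
    using assms(1) by (simp only: quad_ints_iff_Tr_Nm Tr_of_rat_mult Nm_mult quad_field_of_rat
        quad_field_mult Nm_of_rat) (simp add: divide_inverse power_inverse mult.commute)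
  finally show ?thesis .
qed

lemma of_rat_in_principal_ideal_iff:
  assumes "g \<noteq> 0"
  shows "of_rat r \<in> principal_ideal (of_rat g) \<longleftrightarrow> r / g \<in> \<int>"
  using assms
  by (simp add: mem_principal_ideal_iff_divide of_rat_in_quad_ints_iff flip: of_rat_divide)

lemma principal_ideal_of_rat_inject:
  assumes "principal_ideal (of_rat g) = principal_ideal (of_rat h)" "g > 0" "h > 0"
  shows "g = h"
proof -
  have "h / g \<in> \<int>" "g / h \<in> \<int>"
    using assms principal_ideal_self[of "of_rat g"] principal_ideal_self[of "of_rat h"]
    by (simp_all flip: of_rat_in_principal_ideal_iff)
  then obtain a b where quotients: "h / g = of_int a" "g / h = of_int b" by (metis Ints_cases)
  have "a > 0" using quotients(1) assms(2,3) by (metis divide_pos_pos of_int_0_less_iff)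
  have "(of_int (a * b) :: rat) = of_int 1" using assms(2,3) by (simp flip: quotients)
  hence "a * b = 1" by (simp only: of_int_eq_iff)
  hence "a = 1" using \<open>a > 0\<close> by (simp add: zmult_eq_1_iff)
  thus ?thesis using quotients(1) assms(2) by simp
qed

lemma rational_elements_cyclic:
  assumes "frac_ideal J"
  obtains g where "g > 0" "\<And>r. of_rat r \<in> J \<longleftrightarrow> r / g \<in> \<int>"
proof -
  obtain m where denominator: "m > 0" "\<And>x. x \<in> J \<Longrightarrow> of_int m * x \<in> \<O>"
    using frac_ideal_denominator[OF assms] by blast
  have "of_int m * r \<in> \<int>" if "of_rat r \<in> J" for r
    using denominator(2)[OF that] of_rat_in_quad_ints_iff[of "of_int m * r"]
    by (simp add: of_rat_mult)
  moreover have "\<exists>r. of_rat r \<in> J \<and> r \<noteq> 0"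
  proof -
    obtain x where nonzero: "x \<in> J" "x \<noteq> 0" using assms by (rule frac_ideal_nonzero)
    have "x \<in> K" using assms nonzero(1) by (rule frac_ideal_in_quad_field)
    have "conjugate (of_int m * x) * x = of_rat (of_int m * Nm x)"
      using mult_conjugate[OF \<open>x \<in> K\<close>] \<open>x \<in> K\<close> by (simp add: conjugate_mult of_rat_mult mult_ac)
    moreover have "conjugate (of_int m * x) * x \<in> J"
      using denominator(2) nonzero(1) by (intro frac_ideal_mult[OF assms]) auto
    moreover have "of_int m * Nm x \<noteq> 0"
      using denominator(1) nonzero(2) Nm_eq_zero_iff[OF \<open>x \<in> K\<close>] by simp
    ultimately show ?thesis by metis
  qed
  ultimately obtain g where "g > 0" "\<And>r. r \<in> {r. of_rat r \<in> J} \<longleftrightarrow> r / g \<in> \<int>"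
    using rat_subgroup_cyclic[of "{r. of_rat r \<in> J}" m] denominator(1) frac_ideal_diff[OF assms]
    by (auto simp: of_rat_diff)
  thus thesis using that by simp
qed

lemma ring_quad_ints: "ring (ring_on \<O>)"
proof (rule ringI)
  show "abelian_group (ring_on \<O>)"
  proof (rule abelian_groupI)
    show "\<exists>y\<in>carrier (ring_on \<O>). y \<oplus>\<^bsub>ring_on \<O>\<^esub> x = \<zero>\<^bsub>ring_on \<O>\<^esub>"
      if "x \<in> carrier (ring_on \<O>)" for x
      using that by (intro bexI[of _ "- x"]) (auto simp: ring_on_def)
  qed (auto simp: ring_on_def)
  show "monoid (ring_on \<O>)" by (rule monoidI) (auto simp: ring_on_def)
qed (auto simp: ring_on_def algebra_simps)

lemma quad_ints_a_inv:
  assumes "x \<in> \<O>"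
  shows "\<ominus>\<^bsub>ring_on \<O>\<^esub> x = - x"
proof -
  interpret ring "ring_on \<O>" by (rule ring_quad_ints)
  show ?thesis using assms by (intro minus_equality) (auto simp: ring_on_def)
qed

lemma ideal_quad_ints_iff_frac_ideal:
  assumes "I \<noteq> {0}"
  shows "ideal I (ring_on \<O>) \<longleftrightarrow> frac_ideal I \<and> I \<subseteq> \<O>"
proof
  assume "ideal I (ring_on \<O>)"
  then interpret ideal I "ring_on \<O>" .
  have "I \<subseteq> \<O>" using a_subset by (simp add: ring_on_def)
  moreover have "frac_ideal I"
  proof (rule frac_idealI)
    show "x + y \<in> I" if "x \<in> I" "y \<in> I" for x y
      using additive_subgroup.a_closed[OF additive_subgroup_axioms that] by (simp add: ring_on_def)
    show "c * x \<in> I" if "c \<in> \<O>" "x \<in> I" for c x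
      using I_l_closed[OF that(2), of c] that(1) by (simp add: ring_on_def)
    show "\<exists>x\<in>I. x \<noteq> 0"
      using assms additive_subgroup.zero_closed[OF additive_subgroup_axioms]
      by (auto simp: ring_on_def)
    show "(1 :: int) > 0" by simp
  qed (use \<open>I \<subseteq> \<O>\<close> in auto)
  ultimately show "frac_ideal I \<and> I \<subseteq> \<O>" by simp
next
  assume frac_I: "frac_ideal I \<and> I \<subseteq> \<O>"
  interpret ring "ring_on \<O>" by (rule ring_quad_ints)
  show "ideal I (ring_on \<O>)"
  proof (rule idealI)
    show "subgroup I (add_monoid (ring_on \<O>))"
    proof (rule group.subgroupI[OF a_group])
      show "inv\<^bsub>add_monoid (ring_on \<O>)\<^esub> x \<in> I" if "x \<in> I" for x
        using frac_I that quad_ints_a_inv[of x] frac_ideal_minus[of I x] by (auto simp: a_inv_def)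
      show "I \<noteq> {}" using frac_I frac_ideal_zero by blast
    qed (use frac_I frac_ideal_add in \<open>auto simp: ring_on_def\<close>)
    show "x \<otimes>\<^bsub>ring_on \<O>\<^esub> y \<in> I" "y \<otimes>\<^bsub>ring_on \<O>\<^esub> x \<in> I" if "y \<in> I" "x \<in> carrier (ring_on \<O>)" for x y
      using that frac_I frac_ideal_mult by (auto simp: ring_on_def mult.commute)
  qed (rule ring_quad_ints)
qed

lemma quad_ints_coset_eq_iff:
  assumes "ideal I (ring_on \<O>)" "x \<in> \<O>" "y \<in> \<O>"
  shows "I +>\<^bsub>ring_on \<O>\<^esub> x = I +>\<^bsub>ring_on \<O>\<^esub> y \<longleftrightarrow> x - y \<in> I"
proof -
  interpret ring "ring_on \<O>" by (rule ring_quad_ints)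
  have "x \<ominus>\<^bsub>ring_on \<O>\<^esub> y = x - y"
    using assms(3) by (simp add: a_minus_def quad_ints_a_inv) (simp add: ring_on_def)
  thus ?thesis
    using quotient_eq_iff_same_a_r_cos[OF assms(1), of x y] assms(2,3) by (simp add: ring_on_def)
qed

lemma order_quad_ints_Quot:
  "Coset.order (ring_on \<O> Quot I) = card ((\<lambda>x. I +>\<^bsub>ring_on \<O>\<^esub> x) ` \<O>)"
proof -
  have "carrier (ring_on \<O> Quot I) = (\<lambda>x. I +>\<^bsub>ring_on \<O>\<^esub> x) ` \<O>"
    unfolding FactRing_def A_RCOSETS_def' by (auto simp: ring_on_def)
  thus ?thesis by (simp add: Coset.order_def)
qed

lemma order_quad_ints_Quot_zero: "Coset.order (ring_on \<O> Quot {0}) = 0"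
proof -
  interpret ring "ring_on \<O>" by (rule ring_quad_ints)
  have "ideal {0} (ring_on \<O>)" using zeroideal by (simp add: ring_on_def)
  hence "inj_on (\<lambda>x. {0} +>\<^bsub>ring_on \<O>\<^esub> x) \<O>" by (simp add: inj_on_def quad_ints_coset_eq_iff)
  moreover have "infinite (range (of_int :: int \<Rightarrow> complex))"
    by (simp add: finite_image_iff inj_on_def)
  hence "infinite \<O>" by (rule infinite_super[rotated]) auto
  ultimately show ?thesis by (simp add: order_quad_ints_Quot finite_image_iff)
qed

section \<open>The norm of an ideal\<close>

text \<open>The rational numbers in \<open>J \<star> conjugate ` J\<close> form a cyclic group, say \<open>\<int> g\<close>. For \<open>x, y \<in> J\<close>
  the trace and the norm of \<open>x * conjugate y / g\<close> are integers, hence \<open>J \<star> conjugate ` J\<close> is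
  generated by \<open>g\<close>.\<close>

lemma ideal_prod_conjugate_principal_ideal:
  assumes frac_J: "frac_ideal J"
  obtains g where "g > 0" "J \<star> conjugate ` J = principal_ideal (of_rat g)"
proof -
  let ?M = "J \<star> conjugate ` J"
  have frac_M: "frac_ideal ?M" using frac_J by blast
  have J_in_K: "x \<in> K" if "x \<in> J" for x using frac_J that by (rule frac_ideal_in_quad_field)
  have Nm_in_M: "of_rat (Nm x) \<in> ?M" if "x \<in> J" for x
    using ideal_prod_mult[OF that imageI[OF that], of conjugate] J_in_K[OF that]
    by (simp add: mult_conjugate)
  have Tr_in_M: "of_rat (Tr (x * conjugate y)) \<in> ?M" if "x \<in> J" "y \<in> J" for x y
  proof -
    have "of_rat (Tr (x * conjugate y)) = x * conjugate y + y * conjugate x"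
      using that J_in_K by (simp add: conjugate_mult mult.commute flip: add_conjugate)
    also have "\<dots> \<in> ?M" using that by (intro ideal_prod_add ideal_prod_mult imageI)
    finally show ?thesis .
  qed
  obtain g where generator: "g > 0" "\<And>r. of_rat r \<in> ?M \<longleftrightarrow> r / g \<in> \<int>"
    using rational_elements_cyclic[OF frac_M] by blast
  have "?M = principal_ideal (of_rat g)"
  proof
    show "?M \<subseteq> principal_ideal (of_rat g)"
    proof (rule ideal_prod_subset)
      fix x z assume "x \<in> J" "z \<in> conjugate ` J"
      then obtain y where preimage: "y \<in> J" "z = conjugate y" by blast
      have "Nm (x * z) / g ^ 2 = (Nm x / g) * (Nm y / g)"
        using \<open>x \<in> J\<close> preimage J_in_K by (simp add: Nm_mult power2_eq_square)
      also have "\<dots> \<in> \<int>" using Nm_in_M \<open>x \<in> J\<close> preimage(1) generator(2) by (intro Ints_mult) auto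
      finally show "x * z \<in> principal_ideal (of_rat g)"
        using Tr_in_M[OF \<open>x \<in> J\<close> preimage(1)] \<open>x \<in> J\<close> preimage J_in_K generator
        by (simp add: mem_principal_ideal_of_rat_iff)
    qed (use generator(1) in \<open>simp add: frac_ideal_add\<close>)
    have "of_rat g \<in> ?M" using generator by simp
    thus "principal_ideal (of_rat g) \<subseteq> ?M" using frac_M by (simp add: principal_ideal_subset_iff)
  qed
  thus thesis using that generator(1) by blast
qed

definition ideal_norm :: "complex set \<Rightarrow> rat" where
  "ideal_norm J = (THE g. g > 0 \<and> J \<star> conjugate ` J = principal_ideal (of_rat g))"

lemma ideal_norm_eqI: "g > 0 \<Longrightarrow> J \<star> conjugate ` J = principal_ideal (of_rat g) \<Longrightarrow> ideal_norm J = g"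
  unfolding ideal_norm_def by (rule the_equality) (auto intro: principal_ideal_of_rat_inject)

lemma ideal_norm_pos: "frac_ideal J \<Longrightarrow> ideal_norm J > 0"
  and ideal_prod_conjugate: "frac_ideal J \<Longrightarrow> J \<star> conjugate ` J = principal_ideal (of_rat (ideal_norm J))"
  using ideal_norm_eqI ideal_prod_conjugate_principal_ideal by metis+

lemma ideal_norm_prod:
  assumes "frac_ideal I" "frac_ideal J"
  shows "ideal_norm (I \<star> J) = ideal_norm I * ideal_norm J"
proof (rule ideal_norm_eqI)
  show "ideal_norm I * ideal_norm J > 0" using assms by (simp add: ideal_norm_pos)
  have "I \<star> J \<star> conjugate ` (I \<star> J) = (I \<star> conjugate ` I) \<star> (J \<star> conjugate ` J)"
    using assms by (simp add: conjugate_image_prod frac_ideal_subset ideal_prod_ac)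
  also have "\<dots> = principal_ideal (of_rat (ideal_norm I * ideal_norm J))"
    using assms ideal_norm_pos[OF assms(2)]
    by (simp add: ideal_prod_conjugate principal_ideal_prod_principal of_rat_mult)
  finally show "I \<star> J \<star> conjugate ` (I \<star> J) = principal_ideal (of_rat (ideal_norm I * ideal_norm J))" .
qed

lemma ideal_norm_principal_ideal:
  assumes "x \<in> K" "x \<noteq> 0"
  shows "ideal_norm (principal_ideal x) = \<bar>Nm x\<bar>"
proof (rule ideal_norm_eqI)
  show "\<bar>Nm x\<bar> > 0" using assms by (simp add: Nm_eq_zero_iff)
  have "principal_ideal x \<star> conjugate ` principal_ideal x = principal_ideal (of_rat (Nm x))"
    using assms
    by (simp add: conjugate_image_principal_ideal principal_ideal_prod_principal mult_conjugate)
  also have "\<dots> = principal_ideal (of_rat \<bar>Nm x\<bar>)"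
    by (simp add: abs_if principal_ideal_minus of_rat_minus)
  finally show "principal_ideal x \<star> conjugate ` principal_ideal x = principal_ideal (of_rat \<bar>Nm x\<bar>)" .
qed

lemma frac_ideal_inverse:
  assumes "frac_ideal J"
  obtains I where "frac_ideal I" "I \<star> J = \<O>"
proof
  let ?c = "inverse (of_rat (ideal_norm J)) :: complex"
  have norm: "ideal_norm J \<noteq> 0" using ideal_norm_pos[OF assms] by simp
  show "frac_ideal (principal_ideal ?c \<star> conjugate ` J)" using assms norm by auto
  have "principal_ideal ?c \<star> conjugate ` J \<star> J = principal_ideal ?c \<star> principal_ideal (of_rat (ideal_norm J))"
    using assms by (simp add: ideal_prod_ac flip: ideal_prod_conjugate)
  also have "\<dots> = \<O>" using norm by (simp add: principal_ideal_prod_principal principal_ideal_one)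
  finally show "principal_ideal ?c \<star> conjugate ` J \<star> J = \<O>" .
qed

lemma ideal_prod_subset_cancel:
  assumes "frac_ideal I" "frac_ideal J" "frac_ideal L" "L \<star> I \<subseteq> L \<star> J"
  shows "I \<subseteq> J"
proof -
  obtain M where inverse: "frac_ideal M" "M \<star> L = \<O>" using assms(3) by (rule frac_ideal_inverse)
  have "M \<star> (L \<star> I) \<subseteq> M \<star> (L \<star> J)" using assms(4) by (rule ideal_prod_mono[OF order_refl])
  thus ?thesis using inverse(2) assms(1,2) by (simp flip: ideal_prod_assoc)
qed

lemma frac_ideal_eqI_norm:
  assumes "frac_ideal I" "frac_ideal J" "I \<subseteq> J" "ideal_norm I = ideal_norm J"
  shows "I = J"
proof
  have "I \<star> conjugate ` J \<subseteq> J \<star> conjugate ` J" using assms(3) by (intro ideal_prod_mono order_refl)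
  also have "\<dots> = I \<star> conjugate ` I" using assms(1,2,4) by (simp add: ideal_prod_conjugate)
  finally have "conjugate ` J \<subseteq> conjugate ` I"
    by (rule ideal_prod_subset_cancel[rotated 3]) (use assms in auto)
  hence "conjugate ` conjugate ` J \<subseteq> conjugate ` conjugate ` I" by (rule image_mono)
  thus "J \<subseteq> I" using assms(1,2) by (simp add: conjugate_image_image frac_ideal_subset)
qed (rule assms(3))

lemma carrier_ideal_group [simp]: "carrier (ideal_group D) = {J. frac_ideal J}"
  and mult_ideal_group [simp]: "I \<otimes>\<^bsub>ideal_group D\<^esub> J = I \<star> J"
  and one_ideal_group [simp]: "\<one>\<^bsub>ideal_group D\<^esub> = \<O>"
  by (simp_all add: ideal_group_def)

sublocale ideals: comm_group "ideal_group D"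
proof (rule comm_groupI)
  show "\<exists>I\<in>carrier (ideal_group D). I \<otimes>\<^bsub>ideal_group D\<^esub> J = \<one>\<^bsub>ideal_group D\<^esub>"
    if "J \<in> carrier (ideal_group D)" for J
    using that by simp (metis frac_ideal_inverse)
qed (simp_all add: ideal_prod_ac)

section \<open>Total positivity\<close>

definition real_embedding :: "real \<Rightarrow> complex \<Rightarrow> real" where
  "real_embedding v z = of_rat (rat_part z) + of_rat (sqrt_part z) * v"

lemma real_embedding_quad [simp]: "real_embedding v (quad p q) = of_rat p + of_rat q * v"
  by (simp add: real_embedding_def)

lemma real_embedding_in_ring_hom:
  assumes "v * v = of_int D"
  shows "real_embedding v \<in> ring_hom (ring_on K) (ring_on UNIV)"
proof -
  have "real_embedding v (x * y) = real_embedding v x * real_embedding v y"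
    if x_in_K: "x \<in> K" and y_in_K: "y \<in> K" for x y
  proof -
    obtain p q where x_eq: "x = quad p q" using x_in_K by (rule quad_field_cases)
    obtain p' q' where y_eq: "y = quad p' q'" using y_in_K by (rule quad_field_cases)
    have "real_embedding v x * real_embedding v y =
        of_rat p * of_rat p' + v * v * (of_rat q * of_rat q') +
        (of_rat p * of_rat q' + of_rat q * of_rat p') * v"
      by (simp add: x_eq y_eq algebra_simps)
    thus ?thesis by (simp add: x_eq y_eq quad_mult assms of_rat_add of_rat_mult)
  qed
  moreover have "real_embedding v (x + y) = real_embedding v x + real_embedding v y"
    if "x \<in> K" "y \<in> K" for x y
    using that by (auto simp: quad_add of_rat_add algebra_simps elim!: quad_field_cases)
  ultimately show ?thesis by (auto simp: ring_hom_def ring_on_def one_eq_quad)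
qed

context
  fixes \<sigma> :: "complex \<Rightarrow> real"
  assumes \<sigma>: "\<sigma> \<in> ring_hom (ring_on K) (ring_on UNIV)"
begin

lemma ring_hom_add: "x \<in> K \<Longrightarrow> y \<in> K \<Longrightarrow> \<sigma> (x + y) = \<sigma> x + \<sigma> y"
  and ring_hom_mult: "x \<in> K \<Longrightarrow> y \<in> K \<Longrightarrow> \<sigma> (x * y) = \<sigma> x * \<sigma> y"
  and ring_hom_one: "\<sigma> 1 = 1"
  using \<sigma> by (auto simp: ring_hom_def ring_on_def)

lemma ring_hom_of_int: "\<sigma> (of_int n) = of_int n"
proof -
  have zero: "\<sigma> 0 = 0" using ring_hom_add[of 0 0] by simp
  have minus_one: "\<sigma> (- 1) = - 1" using ring_hom_add[of 1 "- 1"] by (simp add: zero ring_hom_one)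
  show ?thesis
  proof (induction n rule: int_induct[where k = 0])
    case (step1 i)
    thus ?case using ring_hom_add[of "of_int i" 1] by (simp add: ring_hom_one)
  next
    case (step2 i)
    thus ?case using ring_hom_add[of "of_int i" "- 1"] by (simp add: minus_one)
  qed (simp add: zero)
qed

lemma ring_hom_of_rat: "\<sigma> (of_rat r) = of_rat r"
proof -
  obtain m z where denominator: "m > 0" "of_int m * r = of_int z" by (rule rat_denominator)
  have "of_int m * \<sigma> (of_rat r) = \<sigma> (of_int m * of_rat r)"
    by (simp add: ring_hom_mult ring_hom_of_int)
  also have "of_int m * of_rat r = (of_rat (of_int m * r) :: complex)" by (simp add: of_rat_mult)
  also have "\<sigma> \<dots> = of_rat (of_int m * r)" by (simp add: denominator(2) ring_hom_of_int)
  finally show ?thesis using denominator(1) by (simp add: of_rat_mult)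
qed

lemma ring_hom_imp_real_embedding:
  obtains v where "v * v = of_int D" "\<And>z. z \<in> K \<Longrightarrow> \<sigma> z = real_embedding v z"
proof
  let ?v = "\<sigma> (quad 0 1)"
  have "?v * ?v = \<sigma> (quad 0 1 * quad 0 1)" by (simp add: ring_hom_mult)
  also have "quad 0 1 * quad 0 1 = of_int D" by (simp add: quad_mult of_int_eq_quad)
  finally show "?v * ?v = of_int D" by (simp only: ring_hom_of_int)
  have "\<sigma> (of_rat p + of_rat q * quad 0 1) = of_rat p + of_rat q * ?v" for p q
    by (simp add: ring_hom_add ring_hom_mult ring_hom_of_rat)
  moreover have "of_rat p + of_rat q * quad 0 1 = quad p q" for p q
    by (simp add: of_rat_eq_quad quad_mult quad_add)
  ultimately show "\<sigma> z = real_embedding ?v z" if "z \<in> K" for z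
    using that by (metis quad_field_cases real_embedding_quad)
qed

end

lemma totally_positive_iff_real_embedding:
  "totally_positive D x \<longleftrightarrow> x \<in> K \<and> x \<noteq> 0 \<and> (\<forall>v. v * v = of_int D \<longrightarrow> real_embedding v x > 0)"
  unfolding totally_positive_def
  by (metis real_embedding_in_ring_hom ring_hom_imp_real_embedding)

lemma real_embedding_mult_conjugate:
  assumes "x \<in> K" "v * v = of_int D"
  shows "real_embedding v x * real_embedding (- v) x = of_rat (Nm x)"
proof -
  obtain p q where x_eq: "x = quad p q" using assms(1) by (rule quad_field_cases)
  have "real_embedding v x * real_embedding (- v) x = of_rat p * of_rat p - v * v * (of_rat q * of_rat q)"
    by (simp add: x_eq algebra_simps)
  also have "\<dots> = of_rat (Nm x)"
    by (simp add: assms(2) x_eq of_rat_diff of_rat_mult power2_eq_square)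
  finally show ?thesis .
qed

lemma real_embedding_add_conjugate:
  "x \<in> K \<Longrightarrow> real_embedding v x + real_embedding (- v) x = of_rat (Tr x)"
  by (auto simp: of_rat_mult elim!: quad_field_cases)

lemma totally_positive_iff:
  "totally_positive D x \<longleftrightarrow> x \<in> K \<and> x \<noteq> 0 \<and> (D > 0 \<longrightarrow> Nm x > 0 \<and> Tr x > 0)"
proof (cases "D > 0")
  case False
  have "v * v \<noteq> of_int D" for v :: real
    using False D_nonzero zero_le_square[of v]
    by (metis linorder_neqE_linordered_idom not_le of_int_less_0_iff)
  thus ?thesis using False by (simp add: totally_positive_iff_real_embedding)
next
  case True
  define s where "s = sqrt (of_int D)"
  have s_square: "s * s = of_int D" using True by (simp add: s_def)
  have "v * v = of_int D \<longleftrightarrow> v = s \<or> v = - s" for v by (metis s_square square_eq_iff)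
  hence "totally_positive D x \<longleftrightarrow>
      x \<in> K \<and> x \<noteq> 0 \<and> real_embedding s x > 0 \<and> real_embedding (- s) x > 0"
    by (auto simp: totally_positive_iff_real_embedding)
  also have "\<dots> \<longleftrightarrow> x \<in> K \<and> x \<noteq> 0 \<and>
      real_embedding s x * real_embedding (- s) x > 0 \<and> real_embedding s x + real_embedding (- s) x > 0"
    by (auto simp: zero_less_mult_iff)
  also have "\<dots> \<longleftrightarrow> x \<in> K \<and> x \<noteq> 0 \<and> Nm x > 0 \<and> Tr x > 0"
    by (simp add: real_embedding_mult_conjugate[OF _ s_square] real_embedding_add_conjugate cong: conj_cong)
  finally show ?thesis using True by simp
qed

lemma totally_positive_in_quad_field: "totally_positive D x \<Longrightarrow> x \<in> K"
  and totally_positive_nonzero: "totally_positive D x \<Longrightarrow> x \<noteq> 0"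
  by (auto simp: totally_positive_def)

lemma Nm_pos_if_D_neg:
  assumes "D < 0" "x \<in> K" "x \<noteq> 0"
  shows "Nm x > 0"
proof -
  obtain p q where x_eq: "x = quad p q" using assms(2) by (rule quad_field_cases)
  have "of_int D * q ^ 2 \<le> 0" using assms(1) by (simp add: mult_nonpos_nonneg)
  hence "Nm x \<ge> 0" unfolding x_eq Nm_quad using zero_le_power2[of p] by linarith
  thus ?thesis using assms(2,3) Nm_eq_zero_iff[of x] by simp
qed

lemma totally_positive_Nm_pos: "totally_positive D x \<Longrightarrow> Nm x > 0"
  using Nm_pos_if_D_neg D_nonzero by (cases "D > 0") (auto simp: totally_positive_iff)

lemmas totally_positiveD =
  totally_positive_in_quad_field totally_positive_nonzero totally_positive_Nm_pos

lemma totally_positive_of_rat: "r > 0 \<Longrightarrow> totally_positive D (of_rat r)"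
  by (auto simp: totally_positive_iff) (simp add: of_rat_eq_quad)

lemma totally_positive_mult:
  "totally_positive D x \<Longrightarrow> totally_positive D y \<Longrightarrow> totally_positive D (x * y)"
  unfolding totally_positive_def by (simp add: ring_hom_mult)

lemma totally_positive_inverse:
  assumes "totally_positive D x"
  shows "totally_positive D (inverse x)"
proof -
  have x_pos: "x \<in> K" "x \<noteq> 0" "Nm x > 0"
    using assms by (auto dest: totally_positiveD)
  have "Tr (inverse x) = inverse (Nm x) * Tr x"
    using x_pos(1) unfolding inverse_eq_conjugate[OF x_pos(1,2)]
    by (simp only: Tr_of_rat_mult Tr_conjugate quad_field_conjugate)
  thus ?thesis using assms x_pos by (auto simp: totally_positive_iff Nm_inverse)
qed

lemma totally_positive_or_minus:
  assumes "x \<in> K" "Nm x > 0"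
  shows "totally_positive D x \<or> totally_positive D (- x)"
proof -
  obtain p q where x_eq: "x = quad p q" using assms(1) by (rule quad_field_cases)
  have "p \<noteq> 0" if "D > 0"
  proof
    assume "p = 0"
    hence "of_int D * q ^ 2 < 0" using assms(2) x_eq by simp
    thus False using that by (simp add: mult_less_0_iff)
  qed
  moreover have "x \<noteq> 0" using assms(2) by auto
  ultimately show ?thesis using assms unfolding totally_positive_iff
    by (auto simp: x_eq quad_minus quad_eq_zero_iff)
qed

section \<open>The narrow class group\<close>

lemma narrow_principal_eq: "narrow_principal D = {principal_ideal x | x. totally_positive D x}"
  by (simp add: narrow_principal_def principal_ideal_def)

lemma totally_positive_frac_ideal: "totally_positive D x \<Longrightarrow> frac_ideal (principal_ideal x)"
  by (intro frac_ideal_principal_ideal totally_positiveD)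

lemma narrow_principal_subgroup: "subgroup (narrow_principal D) (ideal_group D)"
proof (rule ideals.subgroupI)
  show "narrow_principal D \<subseteq> carrier (ideal_group D)"
    by (auto simp: narrow_principal_eq totally_positive_frac_ideal)
  show "narrow_principal D \<noteq> {}"
    using totally_positive_of_rat[of 1] by (auto simp: narrow_principal_eq)
next
  fix I assume "I \<in> narrow_principal D"
  then obtain x where I_eq: "I = principal_ideal x" "totally_positive D x"
    by (auto simp: narrow_principal_eq)
  hence "principal_ideal (inverse x) \<star> principal_ideal x = \<O>"
    by (simp add: principal_ideal_prod_principal totally_positiveD
        principal_ideal_one)
  hence "inv\<^bsub>ideal_group D\<^esub> I = principal_ideal (inverse x)"
    using I_eq
    by (intro ideals.inv_equality) (auto simp: totally_positive_frac_ideal totally_positive_inverse)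
  thus "inv\<^bsub>ideal_group D\<^esub> I \<in> narrow_principal D"
    using I_eq(2) totally_positive_inverse by (auto simp: narrow_principal_eq)
next
  fix I J assume "I \<in> narrow_principal D" "J \<in> narrow_principal D"
  then obtain x y where IJ_eq: "I = principal_ideal x" "J = principal_ideal y"
      "totally_positive D x" "totally_positive D y"
    by (auto simp: narrow_principal_eq)
  hence "I \<star> J = principal_ideal (x * y)"
    by (simp add: principal_ideal_prod_principal totally_positiveD)
  thus "I \<otimes>\<^bsub>ideal_group D\<^esub> J \<in> narrow_principal D"
    using IJ_eq(3,4) totally_positive_mult by (auto simp: narrow_principal_eq)
qed

sublocale narrow_principals: normal "narrow_principal D" "ideal_group D"
  by (intro ideals.subgroup_imp_normal narrow_principal_subgroup)

abbreviation Cl :: "complex set set monoid" where "Cl \<equiv> narrow_class_group D"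

sublocale narrow_classes: comm_group Cl
  unfolding narrow_class_group_def by (rule ideals.abelian_FactGroup[OF narrow_principal_subgroup])

lemma carrier_narrow_class_group: "carrier Cl = narrow_class D ` {J. frac_ideal J}"
  by (simp add: narrow_class_group_def narrow_class_def carrier_FactGroup)

lemma narrow_class_prod:
  "frac_ideal I \<Longrightarrow> frac_ideal J \<Longrightarrow> narrow_class D (I \<star> J) = narrow_class D I \<otimes>\<^bsub>Cl\<^esub> narrow_class D J"
  using narrow_principals.rcos_sum[of I J] by (simp add: narrow_class_group_def narrow_class_def)

lemma narrow_class_eq_one_iff:
  assumes "frac_ideal J"
  shows "narrow_class D J = \<one>\<^bsub>Cl\<^esub> \<longleftrightarrow> (\<exists>x. totally_positive D x \<and> J = principal_ideal x)"
proof -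
  have "narrow_class D J = \<one>\<^bsub>Cl\<^esub> \<longleftrightarrow> J \<in> narrow_principal D"
    unfolding narrow_class_def narrow_class_group_def
    using ideals.coset_join1[of "narrow_principal D" J] ideals.coset_join2[of J "narrow_principal D"]
      assms narrow_principal_subgroup by auto
  thus ?thesis by (auto simp: narrow_principal_eq)
qed

lemma narrow_class_principal_ideal_prod:
  assumes "frac_ideal J" "totally_positive D x"
  shows "narrow_class D (principal_ideal x \<star> J) = narrow_class D J"
proof -
  have "frac_ideal (principal_ideal x)" using assms(2) by (rule totally_positive_frac_ideal)
  moreover from this have "narrow_class D (principal_ideal x) = \<one>\<^bsub>Cl\<^esub>"
    using assms(2) by (auto simp: narrow_class_eq_one_iff)
  moreover have "narrow_class D J \<in> carrier Cl"
    using assms(1) by (auto simp: carrier_narrow_class_group)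
  ultimately show ?thesis using assms(1) by (simp add: narrow_class_prod)
qed

section \<open>Hilbert 90 and the 2-torsion of the squares\<close>

lemma frac_ideal_sum:
  assumes "frac_ideal I" "frac_ideal J"
  shows "frac_ideal {x + y | x y. x \<in> I \<and> y \<in> J}" (is "frac_ideal ?M")
proof -
  obtain m where denominator_I: "m > 0" "\<And>x. x \<in> I \<Longrightarrow> of_int m * x \<in> \<O>"
    using frac_ideal_denominator[OF assms(1)] by blast
  obtain n where denominator_J: "n > 0" "\<And>x. x \<in> J \<Longrightarrow> of_int n * x \<in> \<O>"
    using frac_ideal_denominator[OF assms(2)] by blast
  show ?thesis
  proof (rule frac_idealI)
    show "?M \<subseteq> K" using assms frac_ideal_in_quad_field by auto
    fix s assume "s \<in> ?M"
    then obtain x y where s_eq: "s = x + y" "x \<in> I" "y \<in> J" by blast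
    have "of_int (m * n) * s = of_int n * (of_int m * x) + of_int m * (of_int n * y)"
      by (simp add: s_eq algebra_simps)
    thus "of_int (m * n) * s \<in> \<O>"
      using denominator_I(2) denominator_J(2) s_eq by (auto simp del: of_int_mult)
    show "c * s \<in> ?M" if "c \<in> \<O>" for c
    proof -
      have "c * s = c * x + c * y" "c * x \<in> I" "c * y \<in> J"
        using s_eq that assms frac_ideal_mult by (auto simp: distrib_left)
      thus ?thesis by blast
    qed
    fix t assume "t \<in> ?M"
    then obtain x' y' where "t = x' + y'" "x' \<in> I" "y' \<in> J" by blast
    hence "s + t = (x + x') + (y + y')" "x + x' \<in> I" "y + y' \<in> J"
      using s_eq assms frac_ideal_add by auto
    thus "s + t \<in> ?M" by blast
  next
    obtain x where "x \<in> I" "x \<noteq> 0" using assms(1) by (rule frac_ideal_nonzero)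
    moreover from this have "x + 0 \<in> ?M" using frac_ideal_zero[OF assms(2)] by blast
    ultimately show "\<exists>x\<in>?M. x \<noteq> 0" by force
    show "m * n > 0" using denominator_I(1) denominator_J(1) by simp
  qed
qed

lemma hilbert90_ideal_norm_one:
  assumes frac_J: "frac_ideal J" and "ideal_norm J = 1"
  obtains B where "frac_ideal B" "J \<star> conjugate ` B = B"
proof
  let ?B = "{x + y | x y. x \<in> \<O> \<and> y \<in> J}"
  have one: "J \<star> conjugate ` J = \<O>"
    using ideal_prod_conjugate[OF frac_J] assms(2) by (simp add: principal_ideal_one)
  show frac_B: "frac_ideal ?B" by (rule frac_ideal_sum[OF frac_ideal_quad_ints frac_J])
  have subset: "J \<star> conjugate ` ?B \<subseteq> ?B"
  proof (rule ideal_prod_subset)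
    fix j z assume "j \<in> J" "z \<in> conjugate ` ?B"
    then obtain x y where z_eq: "x \<in> \<O>" "y \<in> J" "z = conjugate (x + y)" by blast
    have "j * z = j * conjugate y + conjugate x * j"
      using z_eq frac_ideal_in_quad_field[OF frac_J] by (simp add: conjugate_add algebra_simps)
    moreover have "j * conjugate y \<in> \<O>"
      using ideal_prod_mult[OF \<open>j \<in> J\<close>, of "conjugate y" "conjugate ` J"] z_eq(2) one by auto
    moreover have "conjugate x * j \<in> J" using frac_ideal_mult[OF frac_J] z_eq(1) \<open>j \<in> J\<close> by auto
    ultimately show "j * z \<in> ?B" by blast
  qed (rule frac_ideal_add[OF frac_B])
  have "conjugate ` (J \<star> conjugate ` ?B) \<subseteq> conjugate ` ?B" using subset by (rule image_mono)
  hence "conjugate ` J \<star> ?B \<subseteq> conjugate ` ?B"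
    using frac_ideal_subset[OF frac_J] frac_ideal_subset[OF frac_B]
    by (subst (asm) conjugate_image_prod) (auto simp: conjugate_image_image)
  hence "J \<star> (conjugate ` J \<star> ?B) \<subseteq> J \<star> conjugate ` ?B" by (rule ideal_prod_mono[OF order_refl])
  moreover have "J \<star> (conjugate ` J \<star> ?B) = ?B" using one frac_B by (simp flip: ideal_prod_assoc)
  ultimately show "J \<star> conjugate ` ?B = ?B" using subset by blast
qed

lemma narrow_class_square_iff_ideal_norm_one:
  "Z \<in> (\<lambda>g. g \<otimes>\<^bsub>Cl\<^esub> g) ` carrier Cl \<longleftrightarrow>
     (\<exists>J. frac_ideal J \<and> ideal_norm J = 1 \<and> Z = narrow_class D J)"
proof
  assume "Z \<in> (\<lambda>g. g \<otimes>\<^bsub>Cl\<^esub> g) ` carrier Cl"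
  then obtain B where square_root: "frac_ideal B" "Z = narrow_class D (B \<star> B)"
    by (auto simp: carrier_narrow_class_group narrow_class_prod)
  define h where "h = inverse (ideal_norm B)"
  have h_norm: "h > 0" "h * ideal_norm B = 1"
    using ideal_norm_pos[OF square_root(1)] by (simp_all add: h_def)
  let ?J = "principal_ideal (of_rat h) \<star> (B \<star> B)"
  have "frac_ideal (principal_ideal (of_rat h))" using h_norm(1) by auto
  hence "frac_ideal ?J" using square_root(1) by blast
  moreover have "ideal_norm ?J = (h * ideal_norm B) ^ 2"
    using \<open>frac_ideal (principal_ideal (of_rat h))\<close> square_root(1) h_norm(1)
    by (simp add: ideal_norm_prod ideal_norm_principal_ideal power2_eq_square)
  moreover have "Z = narrow_class D ?J"
    using square_root h_norm(1)
    by (simp add: narrow_class_principal_ideal_prod totally_positive_of_rat)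
  ultimately show "\<exists>J. frac_ideal J \<and> ideal_norm J = 1 \<and> Z = narrow_class D J"
    using h_norm(2) by auto
next
  assume "\<exists>J. frac_ideal J \<and> ideal_norm J = 1 \<and> Z = narrow_class D J"
  then obtain J where norm_one: "frac_ideal J" "ideal_norm J = 1" "Z = narrow_class D J" by blast
  obtain B where quotient: "frac_ideal B" "J \<star> conjugate ` B = B"
    using norm_one(1,2) by (rule hilbert90_ideal_norm_one)
  have "B \<star> B = (J \<star> conjugate ` B) \<star> B" by (simp only: quotient(2))
  also have "\<dots> = (B \<star> conjugate ` B) \<star> J" by (simp only: ideal_prod_ac)
  also have "\<dots> = principal_ideal (of_rat (ideal_norm B)) \<star> J"
    using quotient(1) by (simp only: ideal_prod_conjugate)
  finally have "narrow_class D (B \<star> B) = Z"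
    using norm_one quotient(1)
    by (simp add: narrow_class_principal_ideal_prod totally_positive_of_rat ideal_norm_pos)
  thus "Z \<in> (\<lambda>g. g \<otimes>\<^bsub>Cl\<^esub> g) ` carrier Cl"
    using quotient(1) by (auto simp: narrow_class_prod carrier_narrow_class_group)
qed

text \<open>For \<open>D < 0\<close> the element \<open>- 1\<close> counts as totally positive and needs a separate witness.\<close>

lemma hilbert90_totally_positive:
  assumes "totally_positive D c" "Nm c = 1"
  obtains e where "totally_positive D e" "e * e = of_rat (Nm e) * c"
proof
  define e where "e = (if c = - 1 then quad 0 1 else 1 + c)"
  have c_norm: "c \<in> K" "c * conjugate c = 1"
    using assms mult_conjugate by (auto dest: totally_positive_in_quad_field)
  have "e \<in> K" using c_norm(1) by (simp add: e_def)
  have "e \<noteq> 0" by (auto simp: e_def quad_eq_zero_iff add_eq_0_iff)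
  have "e = c * conjugate e"
    using c_norm
    by (cases "c = - 1") (simp_all add: e_def quad_minus conjugate_add distrib_left add.commute)
  hence "e * e = (e * conjugate e) * c" by (metis mult.assoc mult.commute)
  thus "e * e = of_rat (Nm e) * c" using mult_conjugate[OF \<open>e \<in> K\<close>] by simp
  show "totally_positive D e"
  proof (cases "D > 0")
    case True
    hence "Tr c > 0" using assms(1) by (simp add: totally_positive_iff)
    moreover have "Tr (- 1) < 0" by (simp add: one_eq_quad quad_minus)
    ultimately have "e = 1 + c" by (auto simp: e_def)
    moreover have "Nm (1 + c) = 2 + Tr c" "Tr (1 + c) = 2 + Tr c"
      using c_norm(1) assms(2) by (simp_all add: Nm_add Tr_add)
    ultimately show ?thesis
      using \<open>Tr c > 0\<close> \<open>e \<in> K\<close> \<open>e \<noteq> 0\<close> unfolding totally_positive_iff by simp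
  qed (use \<open>e \<in> K\<close> \<open>e \<noteq> 0\<close> in \<open>simp add: totally_positive_iff\<close>)
qed

lemma self_conjugate_iff_ideal_square:
  assumes "frac_ideal I"
  shows "conjugate ` I = I \<longleftrightarrow> I \<star> I = principal_ideal (of_rat (ideal_norm I))"
proof
  assume "I \<star> I = principal_ideal (of_rat (ideal_norm I))"
  hence "I \<star> I = I \<star> conjugate ` I" using assms by (simp add: ideal_prod_conjugate)
  hence "I \<subseteq> conjugate ` I" "conjugate ` I \<subseteq> I"
    using assms by (auto intro: ideal_prod_subset_cancel[THEN subsetD, rotated 4])
  thus "conjugate ` I = I" by blast
qed (use ideal_prod_conjugate[OF assms] in simp)

lemma squares_2torsion_if_self_conjugate:
  assumes self_conjugate: "frac_ideal I" "conjugate ` I = I"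
    and x_norm: "x \<in> K" "Nm x = ideal_norm I"
  shows "narrow_class D I \<in> squares_2torsion Cl"
proof -
  have "totally_positive D x \<or> totally_positive D (- x)"
    using x_norm self_conjugate(1)
    by (intro totally_positive_or_minus) (simp_all add: ideal_norm_pos)
  then obtain y where y_pos: "totally_positive D y" "Nm y = ideal_norm I"
    using x_norm by (metis Nm_minus)
  have y_inverse: "totally_positive D (inverse y)" using y_pos(1) by (rule totally_positive_inverse)
  let ?J = "principal_ideal (inverse y) \<star> I"
  have "frac_ideal (principal_ideal (inverse y))"
    using y_inverse by (rule totally_positive_frac_ideal)
  hence "frac_ideal ?J" "ideal_norm ?J = 1"
    using y_pos self_conjugate(1) ideal_norm_pos[OF self_conjugate(1)] y_inverse
    by (auto simp: ideal_norm_prod ideal_norm_principal_ideal Nm_inverse totally_positiveD)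
  moreover have "narrow_class D ?J = narrow_class D I"
    using self_conjugate(1) y_inverse by (rule narrow_class_principal_ideal_prod)
  ultimately have "narrow_class D I \<in> (\<lambda>g. g \<otimes>\<^bsub>Cl\<^esub> g) ` carrier Cl"
    unfolding narrow_class_square_iff_ideal_norm_one by metis
  moreover have "I \<star> I = principal_ideal (of_rat (ideal_norm I))"
    using self_conjugate by (simp add: self_conjugate_iff_ideal_square)
  hence "narrow_class D (I \<star> I) = \<one>\<^bsub>Cl\<^esub>"
    using narrow_class_eq_one_iff[of "I \<star> I"] self_conjugate(1)
      totally_positive_of_rat[OF ideal_norm_pos] by blast
  ultimately show ?thesis
    using self_conjugate(1) by (simp add: squares_2torsion_def narrow_class_prod)
qed

lemma squares_2torsion_imp_self_conjugate:
  assumes "Z \<in> squares_2torsion Cl"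
  obtains I x where "frac_ideal I" "conjugate ` I = I" "x \<in> K" "Nm x = ideal_norm I"
    "Z = narrow_class D I"
proof -
  have "Z \<in> (\<lambda>g. g \<otimes>\<^bsub>Cl\<^esub> g) ` carrier Cl" using assms by (simp add: squares_2torsion_def)
  then obtain J where norm_one: "frac_ideal J" "ideal_norm J = 1" "Z = narrow_class D J"
    unfolding narrow_class_square_iff_ideal_norm_one by blast
  have "narrow_class D (J \<star> J) = \<one>\<^bsub>Cl\<^esub>"
    using assms norm_one by (simp add: squares_2torsion_def narrow_class_prod)
  then obtain c where J_square: "totally_positive D c" "J \<star> J = principal_ideal c"
    using norm_one(1) by (auto simp: narrow_class_eq_one_iff)
  have "\<bar>Nm c\<bar> = ideal_norm (J \<star> J)"
    using J_square by (simp add: ideal_norm_principal_ideal totally_positiveD)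
  hence "Nm c = 1"
    using norm_one totally_positive_Nm_pos[OF J_square(1)] by (simp add: ideal_norm_prod)
  then obtain e where e_square: "totally_positive D e" "e * e = of_rat (Nm e) * c"
    using J_square(1) hilbert90_totally_positive by blast
  have e_inverse: "totally_positive D (inverse e)"
    using e_square(1) by (rule totally_positive_inverse)
  have e_nonzero: "inverse e \<in> K" "inverse e \<noteq> 0" "e \<noteq> 0" "Nm e \<noteq> 0"
    using e_inverse e_square(1) totally_positive_Nm_pos[OF e_square(1)]
    by (auto dest: totally_positiveD)
  let ?I = "principal_ideal (inverse e) \<star> J"
  have frac_I: "frac_ideal ?I" using norm_one(1) e_nonzero by blast
  have norm: "ideal_norm ?I = Nm (inverse e)"
    using norm_one(1,2) e_nonzero totally_positive_Nm_pos[OF e_inverse]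
    by (simp add: ideal_norm_prod ideal_norm_principal_ideal)
  have "?I \<star> ?I = (principal_ideal (inverse e) \<star> principal_ideal (inverse e)) \<star> (J \<star> J)"
    by (simp only: ideal_prod_ac)
  also have "\<dots> = principal_ideal (c * inverse (e * e))"
    using e_nonzero J_square by (simp add: principal_ideal_prod_principal totally_positiveD mult_ac)
  also have "c * inverse (e * e) = of_rat (Nm (inverse e))"
    using e_nonzero totally_positive_nonzero[OF J_square(1)] e_square(1) unfolding e_square(2)
    by (simp add: Nm_inverse totally_positive_in_quad_field of_rat_inverse)
  finally have "conjugate ` ?I = ?I"
    using frac_I by (simp add: self_conjugate_iff_ideal_square norm)
  moreover have "Z = narrow_class D ?I"
    unfolding norm_one(3)
    using norm_one(1) e_inverse by (rule narrow_class_principal_ideal_prod[symmetric])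
  ultimately show thesis using that[OF frac_I _ e_nonzero(1)] norm by simp
qed

end

section \<open>The integral basis\<close>

locale fundamental_quadratic_field =
  fixes D :: int
  assumes fundamental: "fundamental_discriminant D"
begin

sublocale quadratic_field D
  by unfold_locales (rule fundamental_discriminant_not_square[OF fundamental])

lemma D_mod_4: "D mod 4 \<in> {0, 1}"
  using fundamental by (simp add: fundamental_discriminant_def)

lemma conductor_is_unit:
  assumes "D = h ^ 2 * E" "E mod 4 \<in> {0, 1}"
  shows "is_unit h"
  using fundamental assms unfolding fundamental_discriminant_def by metis

lemma common_divisor_is_unit:
  fixes T N h :: int
  assumes "T ^ 2 - 4 * N = D" "h dvd T" "h ^ 2 dvd N"
  shows "is_unit h"
proof -
  obtain u n where TN_eq: "T = h * u" "N = h ^ 2 * n" using assms(2,3) by (auto elim!: dvdE)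
  have "D = h ^ 2 * (u ^ 2 - 4 * n)"
    using assms(1) TN_eq by (simp add: power_mult_distrib algebra_simps)
  moreover have "(u ^ 2 - 4 * n) mod 4 \<in> {0, 1}"
    using int_square_mod_4[of u] by (simp add: mod_diff_eq[symmetric])
  ultimately show ?thesis by (rule conductor_is_unit)
qed

lemma int_if_discriminant_mult_square:
  fixes y :: rat
  assumes y_square: "of_int D * y ^ 2 = of_int (t ^ 2 - 4 * n)"
  shows "y \<in> \<int>"
proof -
  obtain a b where quotient: "quotient_of y = (a, b)" by fastforce
  have y_eq: "b > 0" "coprime a b" "y = of_int a / of_int b"
    using quotient_of_denom_pos[OF quotient] quotient_of_coprime[OF quotient]
      quotient_of_div[OF quotient] by auto
  have "(of_int (D * a ^ 2) :: rat) = of_int ((t ^ 2 - 4 * n) * b ^ 2)"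
    using y_square y_eq(1) by (simp add: y_eq(3) power_divide field_simps)
  hence Dab: "D * a ^ 2 = (t ^ 2 - 4 * n) * b ^ 2" by (simp only: of_int_eq_iff)
  hence "b ^ 2 dvd D * a ^ 2" by simp
  hence "b ^ 2 dvd D" using y_eq(2) by (simp add: coprime_commute coprime_dvd_mult_left_iff)
  then obtain E where D_eq: "D = b ^ 2 * E" by auto
  have "b ^ 2 * (E * a ^ 2) = b ^ 2 * (t ^ 2 - 4 * n)" using Dab D_eq by (simp add: algebra_simps)
  hence E_square: "E * a ^ 2 = t ^ 2 - 4 * n" using y_eq(1) by simp
  have "E mod 4 \<in> {0, 1}"
  proof (cases "odd b")
    case True
    hence "D mod 4 = E mod 4"
      using mod_mult_left_eq[of "b ^ 2" 4 E] by (simp add: D_eq odd_square_mod_4)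
    thus ?thesis using D_mod_4 by simp
  next
    case False
    hence "odd a" using y_eq(2) by auto
    hence "E mod 4 = (E * a ^ 2) mod 4"
      using mod_mult_right_eq[of E "a ^ 2" 4] by (simp add: odd_square_mod_4)
    also have "\<dots> = t ^ 2 mod 4" unfolding E_square by (simp add: mod_diff_eq[symmetric])
    finally show ?thesis using int_square_mod_4[of t] by simp
  qed
  with D_eq have "is_unit b" by (rule conductor_is_unit)
  hence "b = 1" using y_eq(1) by simp
  thus ?thesis using y_eq(3) by simp
qed

definition \<omega> :: complex where "\<omega> = quad (of_int D / 2) (1 / 2)"

definition Nm_\<omega> :: int where "Nm_\<omega> = (D * D - D) div 4"

lemma four_Nm_\<omega>: "4 * Nm_\<omega> = D * D - D"
proof -
  have "4 dvd D \<or> 4 dvd D - 1" using D_mod_4 by (auto simp: mod_eq_dvd_iff[of D 4 1, simplified])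
  hence "4 dvd D * (D - 1)" by auto
  thus ?thesis by (simp add: Nm_\<omega>_def right_diff_distrib)
qed

lemma of_int_Nm_\<omega>: "of_int Nm_\<omega> = (of_int D * of_int D - of_int D) / (4 :: rat)"
  using arg_cong[OF four_Nm_\<omega>, of "of_int :: int \<Rightarrow> rat"] by simp

lemma rat_coords_eq_quad: "of_rat x + of_rat y * \<omega> = quad (x + y * of_int D / 2) (y / 2)"
  unfolding \<omega>_def of_rat_eq_quad quad_mult quad_add by simp

lemma int_coords_eq_quad:
  "of_int i + of_int j * \<omega> = quad (of_int i + of_int j * of_int D / 2) (of_int j / 2)"
  using rat_coords_eq_quad[of "of_int i" "of_int j"] by simp

lemma int_coords_inject: "of_int i + of_int j * \<omega> = of_int i' + of_int j' * \<omega> \<longleftrightarrow> i = i' \<and> j = j'"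
  by (auto simp: int_coords_eq_quad quad_inject)

lemma Nm_int_coords: "Nm (of_int i + of_int j * \<omega>) = of_int (i ^ 2 + D * i * j + Nm_\<omega> * j ^ 2)"
  unfolding int_coords_eq_quad by (simp add: of_int_Nm_\<omega> power2_eq_square field_simps)

lemma Tr_int_coords: "Tr (of_int i + of_int j * \<omega>) = of_int (2 * i + D * j)"
  unfolding int_coords_eq_quad by (simp add: algebra_simps)

lemma discriminant_int_coords:
  "(2 * i + D * j) ^ 2 - 4 * (i ^ 2 + D * i * j + Nm_\<omega> * j ^ 2) = D * j ^ 2"
proof -
  have "(2 * i + D * j) ^ 2 - 4 * (i ^ 2 + D * i * j + Nm_\<omega> * j ^ 2) = D * D * j ^ 2 - (4 * Nm_\<omega>) * j ^ 2"
    by (simp add: power2_eq_square algebra_simps)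
  thus ?thesis unfolding four_Nm_\<omega> by (simp add: algebra_simps)
qed

definition shift_trace :: "int \<Rightarrow> int" where "shift_trace t = 2 * t + D"
definition shift_norm :: "int \<Rightarrow> int" where "shift_norm t = t ^ 2 + D * t + Nm_\<omega>"

lemma Tr_shift: "Tr (of_int t + \<omega>) = of_int (shift_trace t)"
  and Nm_shift: "Nm (of_int t + \<omega>) = of_int (shift_norm t)"
  using Tr_int_coords[of t 1] Nm_int_coords[of t 1]
  by (simp_all add: shift_trace_def shift_norm_def)

lemma shift_discriminant: "shift_trace t ^ 2 - 4 * shift_norm t = D"
  using discriminant_int_coords[of t 1] by (simp add: shift_trace_def shift_norm_def)

lemma shift_common_divisor_is_unit: "h dvd shift_trace t \<Longrightarrow> h ^ 2 dvd shift_norm t \<Longrightarrow> is_unit h"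
  using shift_discriminant by (rule common_divisor_is_unit)

lemma gcd_shift:
  assumes "n > 0" "n dvd shift_norm t"
  shows "gcd (gcd (n * n) (n * shift_trace t)) (shift_norm t) = n"
proof -
  obtain k where norm_eq: "shift_norm t = n * k" using assms(2) ..
  let ?h = "gcd (gcd n (shift_trace t)) k"
  have "?h dvd shift_trace t" by (meson dvd_trans gcd_dvd1 gcd_dvd2)
  moreover have "?h ^ 2 dvd shift_norm t"
    unfolding norm_eq power2_eq_square by (intro mult_dvd_mono) (auto intro: dvd_trans[OF gcd_dvd1])
  ultimately have "is_unit ?h" by (rule shift_common_divisor_is_unit)
  hence "?h = 1" by simp
  moreover have "gcd (gcd (n * n) (n * shift_trace t)) (shift_norm t) = n * ?h"
    using assms(1) by (simp add: norm_eq gcd_mult_left)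
  ultimately show ?thesis by simp
qed

lemma \<omega>_in_quad_field [simp]: "\<omega> \<in> K"
  by (simp add: \<omega>_def)

lemma int_coords_in_quad_ints [simp]: "of_int i + of_int j * \<omega> \<in> \<O>"
  by (simp add: quad_ints_iff_Tr_Nm Nm_int_coords Tr_int_coords)

lemma \<omega>_in_quad_ints [simp]: "\<omega> \<in> \<O>"
  using int_coords_in_quad_ints[of 0 1] by simp

lemma \<omega>_square: "\<omega> * \<omega> = of_int D * \<omega> - of_int Nm_\<omega>"
  using quadratic_equation[of \<omega>] Tr_int_coords[of 0 1] Nm_int_coords[of 0 1] by simp

lemma quad_ints_cases [elim?]:
  assumes "z \<in> \<O>"
  obtains i j where "z = of_int i + of_int j * \<omega>"
proof -
  obtain p q where z_eq: "z = quad p q"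
    using assms by (meson quad_ints_in_quad_field quad_field_cases)
  obtain t n where trace: "2 * p = of_int t" and norm: "p ^ 2 - of_int D * q ^ 2 = of_int n"
    using assms by (auto simp: quad_ints_iff_Tr_Nm z_eq elim!: Ints_cases)
  have p_eq: "p = of_int t / 2" using trace by simp
  have "of_int D * (2 * q) ^ 2 = of_int (t ^ 2 - 4 * n)"
    using norm by (simp add: p_eq power2_eq_square field_simps)
  moreover from this obtain j where q_double: "2 * q = of_int j"
    using int_if_discriminant_mult_square Ints_cases by metis
  ultimately have "(of_int (D * j ^ 2) :: rat) = of_int (t ^ 2 - 4 * n)" by simp
  hence "D * j ^ 2 = t ^ 2 - 4 * n" by (simp only: of_int_eq_iff)
  hence "even (D * j ^ 2) \<longleftrightarrow> even (t ^ 2 - 4 * n)" by simp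
  hence "even (t - D * j)" by simp
  then obtain i where "t - D * j = 2 * i" by (rule dvdE)
  hence t_eq: "t = 2 * i + D * j" by simp
  have q_eq: "q = of_int j / 2" using q_double by (simp add: field_simps)
  have "z = of_int i + of_int j * \<omega>"
    unfolding z_eq int_coords_eq_quad p_eq q_eq t_eq by (simp add: add_divide_distrib mult.commute)
  thus thesis by (rule that)
qed

lemma rat_coords_in_quad_ints_iff: "of_rat x + of_rat y * \<omega> \<in> \<O> \<longleftrightarrow> x \<in> \<int> \<and> y \<in> \<int>"
proof
  assume "of_rat x + of_rat y * \<omega> \<in> \<O>"
  then obtain i j where "of_rat x + of_rat y * \<omega> = of_int i + of_int j * \<omega>"
    by (rule quad_ints_cases)
  hence "x = of_int i \<and> y = of_int j"
    by (auto simp: rat_coords_eq_quad int_coords_eq_quad quad_inject)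
  thus "x \<in> \<int> \<and> y \<in> \<int>" by simp
next
  assume "x \<in> \<int> \<and> y \<in> \<int>"
  then obtain i j where "x = of_int i" "y = of_int j" by (auto elim!: Ints_cases)
  thus "of_rat x + of_rat y * \<omega> \<in> \<O>" by simp
qed

definition \<omega>_coeff :: "complex \<Rightarrow> rat" where "\<omega>_coeff z = 2 * sqrt_part z"

lemma \<omega>_coeff_rat_coords: "\<omega>_coeff (of_rat x + of_rat y * \<omega>) = y"
  by (simp add: \<omega>_coeff_def rat_coords_eq_quad)

lemma \<omega>_coeff_of_rat_mult_\<omega>: "\<omega>_coeff (of_rat r * \<omega>) = r"
  using \<omega>_coeff_rat_coords[of 0 r] by simp

lemma \<omega>_coeff_diff: "x \<in> K \<Longrightarrow> y \<in> K \<Longrightarrow> \<omega>_coeff (x - y) = \<omega>_coeff x - \<omega>_coeff y"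
  and \<omega>_coeff_of_rat_mult: "x \<in> K \<Longrightarrow> \<omega>_coeff (of_rat r * x) = r * \<omega>_coeff x"
  by (auto simp: \<omega>_coeff_def of_rat_eq_quad quad_diff quad_mult elim!: quad_field_cases)

lemma \<omega>_coeff_quad_ints: "x \<in> \<O> \<Longrightarrow> \<omega>_coeff x \<in> \<int>"
  using \<omega>_coeff_rat_coords[of "of_int _" "of_int _"] by (auto elim!: quad_ints_cases)

lemma \<omega>_coeff_zero_imp_rational:
  assumes "x \<in> K" "\<omega>_coeff x = 0"
  obtains r where "x = of_rat r"
  using assms by (auto simp: \<omega>_coeff_def of_rat_eq_quad elim!: quad_field_cases)

section \<open>Ideals as lattices\<close>

definition quad_lattice :: "int \<Rightarrow> int \<Rightarrow> complex set" where
  "quad_lattice n t = {of_int i + of_int j * \<omega> | i j. n dvd i - t * j}"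

lemma int_coords_in_lattice_iff: "of_int i + of_int j * \<omega> \<in> quad_lattice n t \<longleftrightarrow> n dvd i - t * j"
  by (auto simp: quad_lattice_def int_coords_inject)

lemma of_int_in_lattice_iff: "of_int i \<in> quad_lattice n t \<longleftrightarrow> n dvd i"
  using int_coords_in_lattice_iff[of i 0] by simp

lemma quad_lattice_eq_span: "quad_lattice n t = {of_int (k * n) + of_int j * (of_int t + \<omega>) | k j. True}"
proof (intro equalityI subsetI)
  fix x assume "x \<in> quad_lattice n t"
  then obtain i j k where "x = of_int i + of_int j * \<omega>" "i - t * j = n * k"
    by (auto simp: quad_lattice_def elim!: dvdE)
  hence "x = of_int (k * n) + of_int j * (of_int t + \<omega>)" by (simp add: eq_diff_eq algebra_simps)
  thus "x \<in> {of_int (k * n) + of_int j * (of_int t + \<omega>) | k j. True}" by blast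
next
  fix x assume "x \<in> {of_int (k * n) + of_int j * (of_int t + \<omega>) | k j. True}"
  then obtain k j where "x = of_int (k * n) + of_int j * (of_int t + \<omega>)" by blast
  hence "x = of_int (k * n + t * j) + of_int j * \<omega>" by (simp add: algebra_simps)
  thus "x \<in> quad_lattice n t" by (simp add: int_coords_in_lattice_iff del: of_int_add of_int_mult)
qed

lemma \<omega>_coeff_image_cyclic:
  assumes frac_J: "frac_ideal J"
  obtains r where "r > 0" "\<And>y. y \<in> \<omega>_coeff ` J \<longleftrightarrow> y / r \<in> \<int>"
proof -
  have J_in_K: "x \<in> K" if "x \<in> J" for x using frac_J that by (rule frac_ideal_in_quad_field)
  obtain m where denominator_J: "m > 0" "\<And>x. x \<in> J \<Longrightarrow> of_int m * x \<in> \<O>"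
    using frac_ideal_denominator[OF frac_J] by blast
  obtain g where generator: "g > 0" "\<And>r. of_rat r \<in> J \<longleftrightarrow> r / g \<in> \<int>"
    using rational_elements_cyclic[OF frac_J] by blast
  have diff: "x - y \<in> \<omega>_coeff ` J" if "x \<in> \<omega>_coeff ` J" "y \<in> \<omega>_coeff ` J" for x y
    using that frac_ideal_diff[OF frac_J] by (auto simp: J_in_K simp flip: \<omega>_coeff_diff)
  have denominator: "of_int m * y \<in> \<int>" if "y \<in> \<omega>_coeff ` J" for y
    using that \<omega>_coeff_quad_ints[OF denominator_J(2)] \<omega>_coeff_of_rat_mult[of _ "of_int m"] J_in_K by auto
  have "of_rat g * \<omega> \<in> J"
    using frac_ideal_mult[OF frac_J, of \<omega> "of_rat g"] generator by (simp add: mult.commute)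
  hence "g \<in> \<omega>_coeff ` J" by (metis \<omega>_coeff_of_rat_mult_\<omega> imageI)
  hence "\<exists>y\<in>\<omega>_coeff ` J. y \<noteq> 0" using generator(1) by (intro bexI[of _ g]) auto
  with diff denominator_J(1) denominator show thesis by (rule rat_subgroup_cyclic[OF _ _ _ _ that])
qed

lemma frac_ideal_eq_span:
  assumes frac_J: "frac_ideal J" and generator: "g > 0" "\<And>q. of_rat q \<in> J \<longleftrightarrow> q / g \<in> \<int>"
    and basis: "x \<in> J" "\<And>y. y \<in> J \<Longrightarrow> \<exists>j. \<omega>_coeff y = of_int j * \<omega>_coeff x"
  shows "J = {of_int k * of_rat g + of_int j * x | k j. True}"
proof (intro equalityI subsetI)
  have J_in_K: "y \<in> K" if "y \<in> J" for y using frac_J that by (rule frac_ideal_in_quad_field)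
  fix y assume "y \<in> J"
  then obtain j where coeff_y: "\<omega>_coeff y = of_int j * \<omega>_coeff x" using basis(2) by blast
  have "y - of_int j * x \<in> J"
    using \<open>y \<in> J\<close> basis(1) frac_ideal_diff[OF frac_J] frac_ideal_mult[OF frac_J] by blast
  moreover have "\<omega>_coeff (y - of_int j * x) = 0"
    using \<omega>_coeff_of_rat_mult[of x "of_int j"] \<open>y \<in> J\<close> basis(1) J_in_K
    by (simp add: \<omega>_coeff_diff coeff_y)
  ultimately obtain q where remainder: "y - of_int j * x = of_rat q" "of_rat q \<in> J"
    using \<omega>_coeff_zero_imp_rational J_in_K by metis
  then obtain k where "q / g = of_int k" using generator(2) Ints_cases by blast
  hence "q = of_int k * g" using generator(1) by (simp add: field_simps)
  hence "y = of_int k * of_rat g + of_int j * x"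
    using remainder(1) by (simp add: of_rat_mult algebra_simps)
  thus "y \<in> {of_int k * of_rat g + of_int j * x | k j. True}" by blast
next
  fix y assume "y \<in> {of_int k * of_rat g + of_int j * x | k j. True}"
  moreover have "of_rat g \<in> J" using generator by simp
  ultimately show "y \<in> J"
    using basis(1) frac_ideal_add[OF frac_J] frac_ideal_mult[OF frac_J] by auto
qed

lemma frac_ideal_lattice_form:
  assumes frac_J: "frac_ideal J"
  obtains r n t where "r > 0" "n > 0" "J = (\<lambda>x. of_rat r * x) ` quad_lattice n t"
proof -
  have J_in_K: "x \<in> K" if "x \<in> J" for x using frac_J that by (rule frac_ideal_in_quad_field)
  obtain r where coeff_generator: "r > 0" "\<And>y. y \<in> \<omega>_coeff ` J \<longleftrightarrow> y / r \<in> \<int>"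
    using \<omega>_coeff_image_cyclic[OF frac_J] by blast
  obtain g where rational_generator: "g > 0" "\<And>q. of_rat q \<in> J \<longleftrightarrow> q / g \<in> \<int>"
    using rational_elements_cyclic[OF frac_J] by blast
  have coeff_multiple: "\<exists>k. \<omega>_coeff x = of_int k * r" if "x \<in> J" for x
    using coeff_generator that by (metis Ints_cases imageI nonzero_divide_eq_eq order_less_irrefl)
  have "\<omega> * of_rat g \<in> J" using frac_ideal_mult[OF frac_J] rational_generator by simp
  moreover have "\<omega>_coeff (\<omega> * of_rat g) = g"
    using \<omega>_coeff_of_rat_mult_\<omega>[of g] by (simp add: mult.commute)
  ultimately obtain n where g_eq: "g = of_int n * r" using coeff_multiple by metis
  have "r \<in> \<omega>_coeff ` J" using coeff_generator by simp
  then obtain x where x_coeff: "x \<in> J" "\<omega>_coeff x = r" by blast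
  have "x - of_rat r * \<omega> \<in> K" "\<omega>_coeff (x - of_rat r * \<omega>) = 0"
    using x_coeff J_in_K by (simp_all add: \<omega>_coeff_diff \<omega>_coeff_of_rat_mult_\<omega>)
  then obtain u where "x - of_rat r * \<omega> = of_rat u" by (rule \<omega>_coeff_zero_imp_rational)
  hence x_coords: "x = of_rat u + of_rat r * \<omega>" by (simp add: algebra_simps)
  have "\<omega> * x = of_rat (- r * of_int Nm_\<omega>) + of_rat (u + r * of_int D) * \<omega>"
    unfolding x_coords distrib_left mult.left_commute[of \<omega>] \<omega>_square
    by (simp add: algebra_simps of_rat_add of_rat_mult of_rat_minus)
  hence "\<omega>_coeff (\<omega> * x) = u + r * of_int D" by (simp only: \<omega>_coeff_rat_coords)
  then obtain k where "u + r * of_int D = of_int k * r"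
    using coeff_multiple[of "\<omega> * x"] frac_ideal_mult[OF frac_J _ x_coeff(1)] by auto
  hence u_eq: "u = r * of_int (k - D)" by (simp add: algebra_simps)
  define t where "t = k - D"
  have x_eq: "x = of_rat r * (of_int t + \<omega>)"
    by (simp add: x_coords u_eq t_def of_rat_mult of_rat_diff algebra_simps)
  have "J = {of_int k * of_rat g + of_int j * x | k j. True}"
    using frac_J rational_generator x_coeff(1) coeff_multiple
    unfolding x_coeff(2)[symmetric] by (rule frac_ideal_eq_span)
  also have "\<dots> = {of_rat r * (of_int (k * n) + of_int j * (of_int t + \<omega>)) | k j. True}"
    by (simp add: x_eq g_eq of_rat_mult algebra_simps)
  also have "\<dots> = (\<lambda>x. of_rat r * x) ` quad_lattice n t" unfolding quad_lattice_eq_span by blast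
  finally show thesis using that[OF coeff_generator(1)] rational_generator(1) coeff_generator(1)
    by (simp add: g_eq zero_less_mult_iff)
qed

lemma int_coords_in_scaled_lattice_iff:
  assumes "m > 0"
  shows "of_int i + of_int j * \<omega> \<in> (\<lambda>x. of_int m * x) ` quad_lattice n t \<longleftrightarrow> m dvd j \<and> m * n dvd i - t * j"
proof
  assume "of_int i + of_int j * \<omega> \<in> (\<lambda>x. of_int m * x) ` quad_lattice n t"
  then obtain i' j' where "n dvd i' - t * j'"
      "of_int i + of_int j * \<omega> = of_int m * (of_int i' + of_int j' * \<omega>)"
    by (auto simp: quad_lattice_def)
  moreover from this have "of_int i + of_int j * \<omega> = of_int (m * i') + of_int (m * j') * \<omega>"
    by (simp add: algebra_simps)
  hence "i = m * i'" "j = m * j'" by (simp_all only: int_coords_inject)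
  moreover from this have "i - t * j = m * (i' - t * j')" by (simp add: algebra_simps)
  ultimately show "m dvd j \<and> m * n dvd i - t * j" by simp
next
  assume "m dvd j \<and> m * n dvd i - t * j"
  then obtain j' k where "j = m * j'" "i - t * j = m * n * k" by (auto elim!: dvdE)
  hence "of_int i + of_int j * \<omega> = of_int m * (of_int (n * k + t * j') + of_int j' * \<omega>)"
    by (simp add: algebra_simps flip: of_int_mult of_int_add)
  thus "of_int i + of_int j * \<omega> \<in> (\<lambda>x. of_int m * x) ` quad_lattice n t"
    by (auto simp: int_coords_in_lattice_iff simp del: of_int_add of_int_mult)
qed

lemma order_Quot_lattice:
  assumes "m > 0" "n > 0" and ideal: "ideal ((\<lambda>x. of_int m * x) ` quad_lattice n t) (ring_on \<O>)"
  shows "Coset.order (ring_on \<O> Quot (\<lambda>x. of_int m * x) ` quad_lattice n t) = nat (m * n * m)"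
proof -
  let ?I = "(\<lambda>x. of_int m * x) ` quad_lattice n t"
  define f where "f i j = ?I +>\<^bsub>ring_on \<O>\<^esub> (of_int i + of_int j * \<omega>)" for i j
  have "f i j = f i' j' \<longleftrightarrow> m dvd j - j' \<and> m * n dvd (i - i') - t * (j - j')" for i j i' j'
  proof -
    have "of_int i + of_int j * \<omega> - (of_int i' + of_int j' * \<omega>) = of_int (i - i') + of_int (j - j') * \<omega>"
      by (simp add: algebra_simps)
    thus ?thesis
      unfolding f_def by (simp only: quad_ints_coset_eq_iff[OF ideal] int_coords_in_quad_ints
          int_coords_in_scaled_lattice_iff[OF assms(1)])
  qed
  hence "card (range (\<lambda>(i, j). f i j)) = nat (m * n * m)"
    using assms(1,2) by (intro card_range_mod_lattice) auto
  moreover have "range (\<lambda>(i, j). f i j) = (\<lambda>x. ?I +>\<^bsub>ring_on \<O>\<^esub> x) ` \<O>"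
    by (auto simp: f_def image_iff elim!: quad_ints_cases)
  ultimately show ?thesis by (simp add: order_quad_ints_Quot)
qed

section \<open>Ambiguous ideals\<close>

text \<open>The product of the ramified primes over the primes dividing \<open>a\<close>: each of them has residue
  degree one and is the only prime over its prime number, so membership is detected by the norm.\<close>

definition ambig :: "nat \<Rightarrow> complex set" where
  "ambig a = {x \<in> \<O>. \<exists>k. Nm x = of_int (int a * k)}"

lemma sqfree_divisor_pos: "sqfree_divisor D a \<Longrightarrow> a > 0"
  by (simp add: sqfree_divisor_def)

lemma sqfree_divisor_dvd_square_iff:
  assumes "sqfree_divisor D a"
  shows "int a dvd c ^ 2 \<longleftrightarrow> int a dvd c"
proof
  assume "int a dvd c ^ 2"
  hence "a dvd nat \<bar>c\<bar> ^ 2" by (simp add: int_dvd_int_iff[symmetric])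
  hence "a dvd nat \<bar>c\<bar>"
    using assms squarefree_dvd_power_imp_dvd[of a "nat \<bar>c\<bar>" 2] unfolding sqfree_divisor_def by blast
  thus "int a dvd c" by simp
qed (simp add: power2_eq_square)

lemma ambig_subset_quad_ints: "ambig a \<subseteq> \<O>"
  by (auto simp: ambig_def)

lemma ambig_in_quad_ints: "x \<in> ambig a \<Longrightarrow> x \<in> \<O>"
  and ambig_in_quad_field: "x \<in> ambig a \<Longrightarrow> x \<in> K"
  by (simp_all add: ambig_def)

lemma int_coords_in_ambig_iff:
  "of_int i + of_int j * \<omega> \<in> ambig a \<longleftrightarrow> int a dvd i ^ 2 + D * i * j + Nm_\<omega> * j ^ 2"
  by (simp only: ambig_def mem_Collect_eq int_coords_in_quad_ints Nm_int_coords of_int_eq_iff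
      dvd_def simp_thms)

lemma shift_in_ambig_iff: "of_int t + \<omega> \<in> ambig a \<longleftrightarrow> int a dvd shift_norm t"
  using int_coords_in_ambig_iff[of t 1 a] by (simp add: shift_norm_def)

lemma of_int_in_ambig_iff: "sqfree_divisor D a \<Longrightarrow> of_int c \<in> ambig a \<longleftrightarrow> int a dvd c"
  using int_coords_in_ambig_iff[of c 0 a] by (simp add: sqfree_divisor_dvd_square_iff)

lemma Tr_ambig:
  assumes "sqfree_divisor D a" "x \<in> ambig a"
  obtains l where "Tr x = of_int (int a * l)"
proof -
  obtain i j where x_eq: "x = of_int i + of_int j * \<omega>"
    using ambig_in_quad_ints[OF assms(2)] by (rule quad_ints_cases)
  have "int a dvd i ^ 2 + D * i * j + Nm_\<omega> * j ^ 2"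
    using assms(2) unfolding x_eq int_coords_in_ambig_iff .
  moreover have "int a dvd D * j ^ 2" using assms(1) by (simp add: sqfree_divisor_def)
  ultimately have "int a dvd (2 * i + D * j) ^ 2"
    using discriminant_int_coords[of i j] by (metis diff_add_cancel dvd_add dvd_mult)
  hence "int a dvd 2 * i + D * j" using assms(1) by (simp add: sqfree_divisor_dvd_square_iff)
  then obtain l where "2 * i + D * j = int a * l" ..
  hence "Tr x = of_int (int a * l)" unfolding x_eq Tr_int_coords by (simp only:)
  thus thesis by (rule that)
qed

lemma ambig_mult:
  assumes "c \<in> \<O>" "x \<in> ambig a"
  shows "c * x \<in> ambig a"
proof -
  obtain n where Nm_c: "Nm c = of_int n" using assms(1) by (rule quad_ints_Nm_cases)
  obtain k where Nm_x: "Nm x = of_int (int a * k)" using assms(2) by (auto simp: ambig_def)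
  have "Nm (c * x) = of_int (int a * (n * k))"
    using assms ambig_in_quad_field by (simp add: Nm_mult Nm_c Nm_x)
  thus ?thesis using assms ambig_in_quad_ints unfolding ambig_def by blast
qed

lemma ambig_conjugate: "x \<in> ambig a \<Longrightarrow> conjugate x \<in> ambig a"
  by (auto simp: ambig_def)

lemma conjugate_image_ambig: "conjugate ` ambig a = ambig a"
proof
  show "ambig a \<subseteq> conjugate ` ambig a"
    by (metis ambig_conjugate ambig_in_quad_field conjugate_conjugate image_eqI subsetI)
qed (auto simp: ambig_conjugate)

lemma ambig_add:
  assumes "sqfree_divisor D a" "x \<in> ambig a" "y \<in> ambig a"
  shows "x + y \<in> ambig a"
proof -
  have "conjugate y * x \<in> ambig a"
    using assms(2,3) by (intro ambig_mult) (simp_all add: ambig_in_quad_ints)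
  then obtain l where trace: "Tr (x * conjugate y) = of_int (int a * l)"
    using Tr_ambig[OF assms(1)] by (metis mult.commute)
  obtain k k' where "Nm x = of_int (int a * k)" "Nm y = of_int (int a * k')"
    using assms(2,3) by (auto simp: ambig_def)
  hence "Nm (x + y) = of_int (int a * (k + k' + l))"
    using assms(2,3) ambig_in_quad_field trace by (simp add: Nm_add algebra_simps)
  moreover have "x + y \<in> \<O>" using assms(2,3) ambig_in_quad_ints by blast
  ultimately show ?thesis unfolding ambig_def by blast
qed

lemma frac_ideal_ambig:
  assumes "sqfree_divisor D a"
  shows "frac_ideal (ambig a)"
proof (rule frac_idealI)
  show "\<exists>x\<in>ambig a. x \<noteq> 0"
    using of_int_in_ambig_iff[OF assms, of "int a"] sqfree_divisor_pos[OF assms]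
    by (intro bexI[of _ "of_int (int a)"]) simp_all
  show "(1 :: int) > 0" by simp
qed (use assms in \<open>auto simp: ambig_in_quad_field ambig_in_quad_ints ambig_add ambig_mult\<close>)

lemma ambig_exists_shift:
  assumes "sqfree_divisor D a"
  obtains t where "of_int t + \<omega> \<in> ambig a"
proof -
  have divisor: "squarefree a" "int a dvd D" using assms by (auto simp: sqfree_divisor_def)
  have "\<exists>t. int a dvd shift_norm t"
  proof (cases "odd a")
    case True
    have "int a dvd 4 * Nm_\<omega>" unfolding four_Nm_\<omega> using divisor(2) by simp
    moreover have "coprime (int a) (2 ^ 2)" using True by (simp only: coprime_power_right_iff) simp
    ultimately have "int a dvd Nm_\<omega>" by (simp add: coprime_dvd_mult_right_iff)
    thus ?thesis by (intro exI[of _ 0]) (simp add: shift_norm_def)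
  next
    case False
    then obtain b where a_eq: "a = 2 * b" by blast
    have "odd b" using divisor(1) squarefreeD[of a 2] a_eq by (auto simp: power2_eq_square)
    have "even D" using divisor(2) a_eq by auto
    hence "4 dvd D" using D_mod_4 by simp presburger
    then obtain e where D_eq: "D = 4 * e" ..
    have "2 * int b dvd 2 * (2 * e)" using divisor(2) by (simp add: a_eq D_eq)
    hence "int b dvd 2 * e" unfolding dvd_mult_cancel_left by simp
    hence "int b dvd e" using \<open>odd b\<close> by (simp add: coprime_dvd_mult_right_iff)
    have "4 * shift_norm e = 4 * (e * (9 * e - 1))"
      unfolding shift_norm_def distrib_left four_Nm_\<omega>
      by (simp add: D_eq power2_eq_square algebra_simps)
    hence "shift_norm e = e * (9 * e - 1)" by simp
    moreover have "2 dvd e * (9 * e - 1)" by simp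
    hence "2 * int b dvd e * (9 * e - 1)"
      using \<open>int b dvd e\<close> \<open>odd b\<close> by (intro divides_mult) auto
    ultimately show ?thesis by (intro exI[of _ e]) (simp add: a_eq)
  qed
  thus thesis using that by (auto simp: shift_in_ambig_iff)
qed

lemma ambig_eq_lattice:
  assumes "sqfree_divisor D a" "of_int t + \<omega> \<in> ambig a"
  shows "ambig a = quad_lattice (int a) t"
proof -
  have frac_ambig: "frac_ideal (ambig a)" using assms(1) by (rule frac_ideal_ambig)
  have coords: "of_int i + of_int j * \<omega> \<in> ambig a \<longleftrightarrow> int a dvd i - t * j" for i j
  proof -
    have shift: "of_int j * (of_int t + \<omega>) \<in> ambig a" using assms(2) by (intro ambig_mult) auto
    have "of_int i + of_int j * \<omega> = of_int (i - t * j) + of_int j * (of_int t + \<omega>)"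
      by (simp add: algebra_simps)
    hence "of_int i + of_int j * \<omega> \<in> ambig a \<longleftrightarrow> of_int (i - t * j) \<in> ambig a"
      using frac_ideal_add[OF frac_ambig _ shift] frac_ideal_diff[OF frac_ambig _ shift]
      by (metis add_diff_cancel_right')
    thus ?thesis unfolding of_int_in_ambig_iff[OF assms(1)] .
  qed
  show ?thesis
  proof (intro equalityI subsetI)
    fix x assume "x \<in> ambig a"
    moreover from this obtain i j where "x = of_int i + of_int j * \<omega>"
      by (meson ambig_in_quad_ints quad_ints_cases)
    ultimately show "x \<in> quad_lattice (int a) t" by (simp add: coords int_coords_in_lattice_iff)
  qed (auto simp: quad_lattice_def coords)
qed

lemma ambig_prod_subset:
  assumes "sqfree_divisor D a"
  shows "ambig a \<star> ambig a \<subseteq> principal_ideal (of_nat a)"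
proof (rule ideal_prod_subset)
  have "a > 0" using assms by (rule sqfree_divisor_pos)
  fix x y assume xy_ambig: "x \<in> ambig a" "y \<in> ambig a"
  hence "x * y \<in> ambig a" by (intro ambig_mult ambig_in_quad_ints)
  then obtain l where trace: "Tr (x * y) = of_int (int a * l)" using Tr_ambig[OF assms] by blast
  obtain k k' where norms: "Nm x = of_int (int a * k)" "Nm y = of_int (int a * k')"
    using xy_ambig by (auto simp: ambig_def)
  have "Tr (x * y) / of_nat a = of_int l" using \<open>a > 0\<close> by (simp add: trace)
  moreover have "Nm (x * y) / of_nat a ^ 2 = of_int (k * k')"
    using \<open>a > 0\<close> xy_ambig by (simp add: Nm_mult ambig_in_quad_field norms power2_eq_square)
  ultimately show "x * y \<in> principal_ideal (of_nat a)"
    using mem_principal_ideal_of_rat_iff[of "x * y" "of_nat a"] xy_ambig \<open>a > 0\<close>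
    by (simp add: ambig_in_quad_field)
qed (use sqfree_divisor_pos[OF assms] in \<open>simp add: frac_ideal_add\<close>)

lemma ambig_prod_ambig:
  assumes "sqfree_divisor D a"
  shows "ambig a \<star> ambig a = principal_ideal (of_nat a)"
proof
  let ?M = "ambig a \<star> ambig a"
  have frac_M: "frac_ideal ?M" using assms by (simp add: frac_ideal_ambig)
  obtain t where shift: "of_int t + \<omega> \<in> ambig a" using assms by (rule ambig_exists_shift)
  define x where "x = of_int t + \<omega>"
  have x_ambig: "x \<in> ambig a" "x \<in> K" using shift ambig_in_quad_field by (auto simp: x_def)
  have a_ambig: "of_int (int a) \<in> ambig a" unfolding of_int_in_ambig_iff[OF assms] by simp
  have "of_int (int a * int a) \<in> ?M" using ideal_prod_mult[OF a_ambig a_ambig] by simp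
  moreover have "of_int (int a * shift_trace t) = of_int (int a) * x + of_int (int a) * conjugate x"
    using add_conjugate[OF x_ambig(2)] by (simp add: x_def Tr_shift flip: distrib_left)
  hence "of_int (int a * shift_trace t) \<in> ?M"
    using ideal_prod_add[OF ideal_prod_mult[OF a_ambig x_ambig(1)]
        ideal_prod_mult[OF a_ambig ambig_conjugate[OF x_ambig(1)]]] by simp
  moreover have "of_int (shift_norm t) \<in> ?M"
    using ideal_prod_mult[OF x_ambig(1) ambig_conjugate[OF x_ambig(1)]] mult_conjugate[OF x_ambig(2)]
    by (simp add: x_def Nm_shift)
  ultimately have "of_int (gcd (gcd (int a * int a) (int a * shift_trace t)) (shift_norm t)) \<in> ?M"
    by (intro frac_ideal_of_int_gcd frac_M)
  hence "of_nat a \<in> ?M"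
    using shift sqfree_divisor_pos[OF assms] by (simp add: gcd_shift shift_in_ambig_iff)
  thus "principal_ideal (of_nat a) \<subseteq> ?M" using frac_M by (simp add: principal_ideal_subset_iff)
qed (rule ambig_prod_subset[OF assms])

lemma ideal_norm_ambig: "sqfree_divisor D a \<Longrightarrow> ideal_norm (ambig a) = of_nat a"
  by (rule ideal_norm_eqI) (simp_all add: sqfree_divisor_pos conjugate_image_ambig ambig_prod_ambig)

text \<open>If \<open>quad_lattice n t\<close> is stable under conjugation, then \<open>n\<close> divides the trace and the norm of
  \<open>t + \<omega>\<close>, hence \<open>D\<close>, and it is squarefree because \<open>D\<close> is fundamental.\<close>

lemma self_conjugate_lattice:
  assumes frac_lattice: "frac_ideal (quad_lattice n t)"
    and self_conjugate: "conjugate ` quad_lattice n t = quad_lattice n t"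
    and "n > 0"
  shows "sqfree_divisor D (nat n)" "quad_lattice n t = ambig (nat n)"
proof -
  define x where "x = of_int t + \<omega>"
  have x_lattice: "x \<in> quad_lattice n t" "x \<in> \<O>" "x \<in> K"
    using int_coords_in_lattice_iff[of t 1 n t] by (simp_all add: x_def)
  have conjugate_x: "conjugate x \<in> quad_lattice n t" using x_lattice(1) self_conjugate by blast
  have "of_int (shift_trace t) \<in> quad_lattice n t"
    using frac_ideal_add[OF frac_lattice x_lattice(1) conjugate_x] add_conjugate[OF x_lattice(3)]
    by (simp add: x_def Tr_shift)
  hence trace: "n dvd shift_trace t" by (simp add: of_int_in_lattice_iff)
  have "of_int (shift_norm t) \<in> quad_lattice n t"
    using frac_ideal_mult[OF frac_lattice x_lattice(2) conjugate_x] mult_conjugate[OF x_lattice(3)]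
    by (simp add: x_def Nm_shift)
  hence norm: "n dvd shift_norm t" by (simp add: of_int_in_lattice_iff)
  have "n dvd shift_trace t ^ 2 - 4 * shift_norm t"
    using trace norm by (intro dvd_diff dvd_mult) (simp_all add: power2_eq_square)
  hence "n dvd D" by (simp only: shift_discriminant)
  moreover have "squarefree (nat n)"
  proof (rule squarefreeI)
    fix h assume "h ^ 2 dvd nat n"
    hence "int h ^ 2 dvd n" using \<open>n > 0\<close> by (simp add: int_dvd_int_iff[symmetric])
    hence "int h dvd shift_trace t" "int h ^ 2 dvd shift_norm t"
      using trace norm by (auto intro: dvd_trans simp: power2_eq_square dest: dvd_mult_left)
    hence "is_unit (int h)" by (rule shift_common_divisor_is_unit)
    thus "h dvd 1" by (metis int_dvd_int_iff of_nat_1)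
  qed
  ultimately show sqfree: "sqfree_divisor D (nat n)" using \<open>n > 0\<close> by (simp add: sqfree_divisor_def)
  show "quad_lattice n t = ambig (nat n)"
    using ambig_eq_lattice[OF sqfree, of t] norm \<open>n > 0\<close> by (simp add: shift_in_ambig_iff)
qed

lemma self_conjugate_imp_ambig:
  assumes frac_J: "frac_ideal J" and "conjugate ` J = J"
  obtains r a where "r > 0" "sqfree_divisor D a" "J = principal_ideal (of_rat r) \<star> ambig a"
proof -
  obtain r n t where lattice_form: "r > 0" "n > 0" "J = (\<lambda>x. of_rat r * x) ` quad_lattice n t"
    using frac_J by (rule frac_ideal_lattice_form)
  let ?P = "principal_ideal (of_rat (inverse r))"
  have frac_P: "frac_ideal ?P" using lattice_form(1) by auto
  have "quad_lattice n t = (\<lambda>x. of_rat (inverse r) * x) ` J"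
    unfolding lattice_form(3) image_image using lattice_form(1) by (simp add: of_rat_inverse flip: mult.assoc)
  also have "\<dots> = ?P \<star> J" using frac_J by (rule principal_ideal_prod[symmetric])
  finally have quad_lattice: "quad_lattice n t = ?P \<star> J" .
  have "frac_ideal (quad_lattice n t)" unfolding quad_lattice using frac_P frac_J by blast
  moreover have "conjugate ` quad_lattice n t = quad_lattice n t"
    unfolding quad_lattice using frac_P frac_J assms(2)
    by (simp only: conjugate_image_prod frac_ideal_subset) (simp add: conjugate_image_principal_ideal)
  ultimately have n_divisor: "sqfree_divisor D (nat n)" "quad_lattice n t = ambig (nat n)"
    using lattice_form(2) by (rule self_conjugate_lattice)+
  have "J = principal_ideal (of_rat r) \<star> ambig (nat n)"
    unfolding principal_ideal_prod[OF frac_ideal_ambig[OF n_divisor(1)]] lattice_form(3) n_divisor(2) ..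
  thus thesis by (rule that[OF lattice_form(1) n_divisor(1)])
qed

lemma order_Quot_scaled_ambig:
  assumes "sqfree_divisor D a" "m > 0" "ideal (principal_ideal (of_int m) \<star> ambig a) (ring_on \<O>)"
  shows "Coset.order (ring_on \<O> Quot (principal_ideal (of_int m) \<star> ambig a)) = nat m ^ 2 * a"
proof -
  obtain t where "of_int t + \<omega> \<in> ambig a" using assms(1) by (rule ambig_exists_shift)
  hence quad_lattice: "ambig a = quad_lattice (int a) t" using assms(1) by (intro ambig_eq_lattice)
  have "principal_ideal (of_int m) \<star> ambig a = (\<lambda>x. of_int m * x) ` quad_lattice (int a) t"
    using principal_ideal_prod[OF frac_ideal_ambig[OF assms(1)]] quad_lattice by simp
  hence "Coset.order (ring_on \<O> Quot (principal_ideal (of_int m) \<star> ambig a)) = nat (m * int a * m)"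
    using order_Quot_lattice[of m "int a" t] assms(2,3) sqfree_divisor_pos[OF assms(1)] by simp
  also have "\<dots> = nat m ^ 2 * a" using assms(2) by (simp add: nat_mult_distrib power2_eq_square)
  finally show ?thesis .
qed

lemma self_conjugate_ideal_eq_ambig:
  assumes ideal_I: "ideal I (ring_on \<O>)" "conjugate ` I = I" "Coset.order (ring_on \<O> Quot I) = a"
    and "squarefree a"
  shows "I = ambig a"
proof -
  have "I \<noteq> {0}" using ideal_I(3) assms(4) order_quad_ints_Quot_zero by auto
  hence frac_I: "frac_ideal I" "I \<subseteq> \<O>"
    using ideal_I(1) by (simp_all add: ideal_quad_ints_iff_frac_ideal)
  obtain r c where r_pos: "r > 0"
    and c_divisor: "sqfree_divisor D c" and I_eq: "I = principal_ideal (of_rat r) \<star> ambig c"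
    using frac_I(1) ideal_I(2) by (rule self_conjugate_imp_ambig)
  have frac_ambig: "frac_ideal (ambig c)" using c_divisor by (rule frac_ideal_ambig)
  obtain t where "of_int t + \<omega> \<in> ambig c" using c_divisor by (rule ambig_exists_shift)
  hence "of_rat r * (of_int t + \<omega>) \<in> \<O>"
    using frac_I(2) unfolding I_eq principal_ideal_prod[OF frac_ambig] by blast
  hence "of_rat (r * of_int t) + of_rat r * \<omega> \<in> \<O>" by (simp add: of_rat_mult distrib_left)
  hence "r \<in> \<int>" by (simp only: rat_coords_in_quad_ints_iff)
  then obtain m where "r = of_int m" by (rule Ints_cases)
  hence m_int: "m > 0" "I = principal_ideal (of_int m) \<star> ambig c" using r_pos I_eq by simp_all
  hence order: "nat m ^ 2 * c = a"
    using order_Quot_scaled_ambig[OF c_divisor m_int(1)] ideal_I(1,3) by simp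
  hence "nat m dvd 1" using assms(4) squarefreeD[of a "nat m"] by auto
  hence "m = 1" using m_int(1) by simp
  thus ?thesis using order m_int(2) frac_ambig by (simp add: principal_ideal_one)
qed

lemma ambiguous_ideal_eq:
  assumes "sqfree_divisor D a"
  shows "ambiguous_ideal D a = ambig a"
  unfolding ambiguous_ideal_def
proof (rule the_equality)
  have frac_ambig: "frac_ideal (ambig a)" using assms by (rule frac_ideal_ambig)
  hence ideal: "ideal (ambig a) (ring_on \<O>)"
    using ideal_quad_ints_iff_frac_ideal[of "ambig a"] ambig_subset_quad_ints
    by (metis frac_ideal_nonzero singletonD)
  moreover have "Coset.order (ring_on \<O> Quot ambig a) = a"
    using order_Quot_scaled_ambig[OF assms, of 1] ideal frac_ambig
    by (simp add: principal_ideal_one)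
  moreover have "quad_conj D (ambig a) = ambig a"
    using frac_ambig by (simp add: quad_conj_eq_image frac_ideal_subset conjugate_image_ambig)
  ultimately show "ideal (ambig a) (ring_on \<O>) \<and> quad_conj D (ambig a) = ambig a \<and>
      Coset.order (ring_on \<O> Quot ambig a) = a" by simp
next
  fix I assume candidate: "ideal I (ring_on \<O>) \<and> quad_conj D I = I \<and> Coset.order (ring_on \<O> Quot I) = a"
  then interpret ideal I "ring_on \<O>" by simp
  have "I \<subseteq> \<O>" using a_subset by (simp add: ring_on_def)
  hence "I \<subseteq> K" using quad_ints_subset_quad_field by (rule subset_trans)
  hence "conjugate ` I = I" using candidate quad_conj_eq_image by simp
  thus "I = ambig a"
    using candidate assms self_conjugate_ideal_eq_ambig[of I a] by (simp add: sqfree_divisor_def)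
qed

text \<open>Both sides are stable under conjugation and have the same norm.\<close>

lemma ambig_prod:
  assumes a_divisor: "sqfree_divisor D a"
    and b_divisor: "sqfree_divisor D b" and c_divisor: "sqfree_divisor D c"
    and "g > 0" and product_eq: "a * b = c * g ^ 2"
  shows "ambig a \<star> ambig b = principal_ideal (of_nat g) \<star> ambig c"
proof -
  have frac_ambig: "frac_ideal (ambig a)" "frac_ideal (ambig b)"
    using a_divisor b_divisor by (simp_all add: frac_ideal_ambig)
  hence "frac_ideal (ambig a \<star> ambig b)" "conjugate ` (ambig a \<star> ambig b) = ambig a \<star> ambig b"
    by (simp_all add: conjugate_image_prod frac_ideal_subset conjugate_image_ambig)
  then obtain r n where r_pos: "r > 0" and n_divisor: "sqfree_divisor D n"
      and prod: "ambig a \<star> ambig b = principal_ideal (of_rat r) \<star> ambig n"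
    by (rule self_conjugate_imp_ambig)
  have "ideal_norm (ambig a \<star> ambig b) = of_nat (c * g ^ 2)"
    using frac_ambig a_divisor b_divisor
    by (simp add: ideal_norm_prod ideal_norm_ambig flip: product_eq)
  moreover have "ideal_norm (ambig a \<star> ambig b) = r ^ 2 * of_nat n"
    unfolding prod using r_pos n_divisor
    by (simp add: ideal_norm_prod ideal_norm_principal_ideal ideal_norm_ambig frac_ideal_ambig)
  ultimately have norm: "r ^ 2 * of_nat n = of_nat (c * g ^ 2)" by simp
  have pos: "c > 0" "n > 0" using c_divisor n_divisor by (simp_all add: sqfree_divisor_pos)
  have "square_class c = square_class (c * g ^ 2)"
    using pos(1) \<open>g > 0\<close> by (simp add: square_class_mult_square)
  also have "\<dots> = square_class n"
    using pos \<open>g > 0\<close> norm by (subst square_class_eq_iff) (auto intro!: exI[of _ r])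
  finally have "n = c"
    using c_divisor n_divisor by (auto simp: sqfree_divisor_def intro: square_class_inject)
  hence "r ^ 2 = of_nat g ^ 2" using norm pos by simp
  hence "r = of_nat g" using r_pos by (simp add: power2_eq_iff_nonneg)
  thus ?thesis using prod \<open>n = c\<close> by simp
qed

lemma ambig_narrow_principal_iff:
  assumes "sqfree_divisor D a"
  shows "narrow_class D (ambig a) = \<one>\<^bsub>Cl\<^esub> \<longleftrightarrow> (\<exists>x\<in>ambig a. Nm x = of_nat a)"
proof -
  have frac_ambig: "frac_ideal (ambig a)" using assms by (rule frac_ideal_ambig)
  have "(\<exists>x. totally_positive D x \<and> ambig a = principal_ideal x) \<longleftrightarrow> (\<exists>x\<in>ambig a. Nm x = of_nat a)"
  proof
    assume "\<exists>x. totally_positive D x \<and> ambig a = principal_ideal x"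
    then obtain x where generator: "totally_positive D x" "ambig a = principal_ideal x" by blast
    hence "\<bar>Nm x\<bar> = of_nat a"
      using ideal_norm_ambig[OF assms] ideal_norm_principal_ideal[of x]
      by (simp add: totally_positiveD)
    hence "Nm x = of_nat a" using totally_positive_Nm_pos[OF generator(1)] by simp
    thus "\<exists>x\<in>ambig a. Nm x = of_nat a" unfolding generator(2) by blast
  next
    assume "\<exists>x\<in>ambig a. Nm x = of_nat a"
    then obtain x where x_norm: "x \<in> ambig a" "Nm x = of_nat a" by blast
    have x_pos: "x \<in> K" "x \<noteq> 0" "Nm x > 0"
      using x_norm sqfree_divisor_pos[OF assms] by (auto simp: ambig_in_quad_field)
    have "principal_ideal x = ambig a"
      using x_norm x_pos frac_ambig by (intro frac_ideal_eqI_norm)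
        (auto simp: principal_ideal_subset_iff ideal_norm_principal_ideal ideal_norm_ambig[OF assms])
    moreover have "totally_positive D x \<or> totally_positive D (- x)"
      using x_pos by (intro totally_positive_or_minus)
    ultimately show "\<exists>x. totally_positive D x \<and> ambig a = principal_ideal x"
      using principal_ideal_minus by metis
  qed
  thus ?thesis using frac_ambig by (simp add: narrow_class_eq_one_iff)
qed

lemma squares_2torsion_eq_ambig:
  "squares_2torsion Cl = {narrow_class D (ambig a) | a. sqfree_divisor D a \<and> (\<exists>x\<in>K. Nm x = of_nat a)}"
proof (intro equalityI subsetI)
  fix Z assume "Z \<in> squares_2torsion Cl"
  then obtain I x where self_conjugate: "frac_ideal I" "conjugate ` I = I"
      and x_norm: "x \<in> K" "Nm x = ideal_norm I" and Z_eq: "Z = narrow_class D I"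
    by (rule squares_2torsion_imp_self_conjugate)
  obtain r a where r_pos: "r > 0"
    and a_divisor: "sqfree_divisor D a" and I_eq: "I = principal_ideal (of_rat r) \<star> ambig a"
    using self_conjugate by (rule self_conjugate_imp_ambig)
  have frac_ambig: "frac_ideal (ambig a)" using a_divisor by (rule frac_ideal_ambig)
  have "ideal_norm I = r ^ 2 * of_nat a"
    unfolding I_eq
    using r_pos a_divisor frac_ambig
    by (simp add: ideal_norm_prod ideal_norm_principal_ideal ideal_norm_ambig)
  hence "Nm (of_rat (inverse r) * x) = of_nat a"
    using r_pos x_norm by (simp only: Nm_mult quad_field_of_rat Nm_of_rat) (simp add: power_inverse)
  moreover have "Z = narrow_class D (ambig a)"
    unfolding Z_eq I_eq
    using frac_ambig r_pos by (simp add: narrow_class_principal_ideal_prod totally_positive_of_rat)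
  ultimately show "Z \<in> {narrow_class D (ambig a) | a. sqfree_divisor D a \<and> (\<exists>x\<in>K. Nm x = of_nat a)}"
    using a_divisor x_norm(1) by blast
next
  fix Z assume "Z \<in> {narrow_class D (ambig a) | a. sqfree_divisor D a \<and> (\<exists>x\<in>K. Nm x = of_nat a)}"
  then obtain a x where "Z = narrow_class D (ambig a)" "sqfree_divisor D a"
      "x \<in> K" "Nm x = of_nat a"
    by blast
  thus "Z \<in> squares_2torsion Cl"
    using squares_2torsion_if_self_conjugate[of "ambig a" x]
    by (simp add: frac_ideal_ambig conjugate_image_ambig ideal_norm_ambig)
qed

section \<open>Points on the torsors\<close>

lemma Nm_eq_iff_rat_torsor:
  assumes "sqfree_divisor D a"
  shows "Nm (quad (of_nat a * r / 2) (s / 2)) = of_nat a \<longleftrightarrow> (r, s) \<in> torsor D a"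
proof -
  obtain b where D_eq: "D = int a * b" using assms by (auto simp: sqfree_divisor_def)
  have "a > 0" using assms by (rule sqfree_divisor_pos)
  hence quotient: "D div int a = b" "of_int D = (of_nat a * of_int b :: rat)"
    by (simp_all add: D_eq)
  have Nm_eq: "Nm (quad (of_nat a * r / 2) (s / 2)) = of_nat a * ((of_nat a * r ^ 2 - of_int b * s ^ 2) / 4)"
    by (simp add: quotient power2_eq_square field_simps)
  show ?thesis unfolding Nm_eq using \<open>a > 0\<close> by (simp add: torsor_def quotient)
qed

lemma int_torsor_iff_rat_torsor:
  "(r, s) \<in> torsor D a \<longleftrightarrow> (of_int r, of_int s) \<in> (torsor D a :: (rat \<times> rat) set)"
proof -
  have "int a * r ^ 2 - (D div int a) * s ^ 2 = 4 \<longleftrightarrow>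
      (of_int (int a * r ^ 2 - (D div int a) * s ^ 2) :: rat) = of_int 4"
    by (simp only: of_int_eq_iff)
  thus ?thesis by (simp add: torsor_def)
qed

lemma rat_torsor_nonempty_iff:
  assumes "sqfree_divisor D a"
  shows "(torsor D a :: (rat \<times> rat) set) \<noteq> {} \<longleftrightarrow> (\<exists>x\<in>K. Nm x = of_nat a)"
proof
  assume "(torsor D a :: (rat \<times> rat) set) \<noteq> {}"
  then obtain r s :: rat where "(r, s) \<in> torsor D a" by auto
  thus "\<exists>x\<in>K. Nm x = of_nat a" using Nm_eq_iff_rat_torsor[OF assms] quad_in_quad_field by blast
next
  assume "\<exists>x\<in>K. Nm x = of_nat a"
  then obtain p q where "Nm (quad p q) = of_nat a" by (metis quad_field_cases)
  moreover have "p = of_nat a * (2 * p / of_nat a) / 2" "q = (2 * q) / 2"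
    using sqfree_divisor_pos[OF assms] by simp_all
  ultimately have "(2 * p / of_nat a, 2 * q) \<in> torsor D a"
    using Nm_eq_iff_rat_torsor[OF assms] by metis
  thus "(torsor D a :: (rat \<times> rat) set) \<noteq> {}" by blast
qed

lemma int_torsor_nonempty_iff:
  assumes "sqfree_divisor D a"
  shows "(torsor D a :: (int \<times> int) set) \<noteq> {} \<longleftrightarrow> (\<exists>x\<in>ambig a. Nm x = of_nat a)"
proof
  assume "(torsor D a :: (int \<times> int) set) \<noteq> {}"
  then obtain r s :: int where point: "(r, s) \<in> torsor D a" by auto
  let ?x = "quad (of_nat a * of_int r / 2) (of_int s / 2)"
  have Nm_eq: "Nm ?x = of_nat a"
    using point Nm_eq_iff_rat_torsor[OF assms] by (simp only: int_torsor_iff_rat_torsor)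
  hence "?x \<in> \<O>" unfolding quad_ints_iff_Tr_Nm by simp
  hence "?x \<in> ambig a" using Nm_eq by (auto simp: ambig_def intro!: exI[of _ 1])
  thus "\<exists>x\<in>ambig a. Nm x = of_nat a" using Nm_eq by blast
next
  assume "\<exists>x\<in>ambig a. Nm x = of_nat a"
  then obtain x where x_norm: "x \<in> ambig a" "Nm x = of_nat a" by blast
  obtain i j where x_eq: "x = of_int i + of_int j * \<omega>"
    using ambig_in_quad_ints[OF x_norm(1)] by (rule quad_ints_cases)
  obtain l where "Tr x = of_int (int a * l)" using assms x_norm(1) by (rule Tr_ambig)
  hence "x = quad (of_nat a * of_int l / 2) (of_int j / 2)"
    by (simp add: x_eq int_coords_eq_quad quad_inject)
  hence "(of_int l, of_int j) \<in> (torsor D a :: (rat \<times> rat) set)"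
    using x_norm(2) Nm_eq_iff_rat_torsor[OF assms] by simp
  thus "(torsor D a :: (int \<times> int) set) \<noteq> {}" by (auto simp flip: int_torsor_iff_rat_torsor)
qed

section \<open>The exact sequence\<close>

lemma Sel2_set_eq: "Sel2_set D = {square_class a | a. sqfree_divisor D a \<and> (\<exists>x\<in>K. Nm x = of_nat a)}"
  unfolding Sel2_set_def using rat_torsor_nonempty_iff by blast

lemma W2_set_eq:
  "W2_set D = {square_class a | a. sqfree_divisor D a \<and> narrow_class D (ambig a) = \<one>\<^bsub>Cl\<^esub>}"
  by (simp add: W2_set_def int_torsor_nonempty_iff ambig_narrow_principal_iff cong: conj_cong)

lemma Sel2_simps [simp]:
  "carrier (Sel2 D) = Sel2_set D"
  "Z \<otimes>\<^bsub>Sel2 D\<^esub> Y = Z \<otimes>\<^bsub>square_class_group\<^esub> Y"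
  by (simp_all add: Sel2_def)

lemma Cl2_2_simps [simp]:
  "carrier (Cl2_2 D) = squares_2torsion Cl"
  "Z \<otimes>\<^bsub>Cl2_2 D\<^esub> Y = Z \<otimes>\<^bsub>Cl\<^esub> Y"
  "\<one>\<^bsub>Cl2_2 D\<^esub> = \<one>\<^bsub>Cl\<^esub>"
  by (simp_all add: Cl2_2_def)

lemma square_class_mult_sqfree_divisor:
  assumes "sqfree_divisor D a" "sqfree_divisor D b"
  obtains g c where "g > 0" "sqfree_divisor D c" "a * b = c * g ^ 2"
    "square_class a \<otimes>\<^bsub>square_class_group\<^esub> square_class b = square_class c"
proof
  define c where "c = squarefree_part (a * b)"
  define g where "g = square_part (a * b)"
  have pos: "a > 0" "b > 0" "c > 0" using assms by (auto simp: sqfree_divisor_pos c_def intro: gr0I)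
  show ab_eq: "a * b = c * g ^ 2" unfolding c_def g_def by (rule squarefree_decompose)
  show "g > 0" using pos(1,2) by (auto simp: g_def intro: gr0I)
  have "int (a * b) dvd D ^ 2"
    using mult_dvd_mono[of "int a" D "int b" D] assms
    by (simp add: sqfree_divisor_def power2_eq_square)
  moreover have "int c dvd int (a * b)" unfolding ab_eq by simp
  ultimately have "int c dvd D ^ 2" by (meson dvd_trans)
  hence "c dvd nat \<bar>D\<bar> ^ 2" by (simp add: int_dvd_int_iff[symmetric])
  have "squarefree c" by (simp add: c_def)
  hence "c dvd nat \<bar>D\<bar>" using \<open>c dvd nat \<bar>D\<bar> ^ 2\<close> by (rule squarefree_dvd_power_imp_dvd)
  thus "sqfree_divisor D c" using \<open>squarefree c\<close> pos(3) by (simp add: sqfree_divisor_def)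
  have "square_class a \<otimes>\<^bsub>square_class_group\<^esub> square_class b = square_class (c * g ^ 2)"
    unfolding ab_eq[symmetric] using pos(1,2) by (rule square_class_mult)
  also have "\<dots> = square_class c" using pos(3) \<open>g > 0\<close> by (rule square_class_mult_square)
  finally show "square_class a \<otimes>\<^bsub>square_class_group\<^esub> square_class b = square_class c" .
qed

lemma Sel2_subgroup: "subgroup (Sel2_set D) square_class_group"
proof (rule square_classes.subgroupI)
  show "Sel2_set D \<subseteq> carrier square_class_group"
    unfolding Sel2_set_eq using square_class_in_carrier sqfree_divisor_pos by blast
  have "sqfree_divisor D 1" by (simp add: sqfree_divisor_def)
  thus "Sel2_set D \<noteq> {}" unfolding Sel2_set_eq by (auto intro!: exI[of _ 1] bexI[of _ 1])
next
  fix Z assume Z_Sel2: "Z \<in> Sel2_set D"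
  then obtain a where Z_eq: "Z = square_class a" "a > 0"
    unfolding Sel2_set_eq using sqfree_divisor_pos by blast
  have "Z \<otimes>\<^bsub>square_class_group\<^esub> Z = square_class (1 * a ^ 2)"
    unfolding Z_eq(1) square_class_mult[OF Z_eq(2) Z_eq(2)] by (simp add: power2_eq_square)
  also have "\<dots> = \<one>\<^bsub>square_class_group\<^esub>"
    using square_class_mult_square[of 1 a] Z_eq(2) by (simp only: square_class_one zero_less_one)
  finally have "Z \<otimes>\<^bsub>square_class_group\<^esub> Z = \<one>\<^bsub>square_class_group\<^esub>" .
  hence "inv\<^bsub>square_class_group\<^esub> Z = Z"
    using Z_eq square_class_in_carrier by (intro square_classes.inv_equality) auto
  thus "inv\<^bsub>square_class_group\<^esub> Z \<in> Sel2_set D" using Z_Sel2 by simp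
next
  fix Z Y assume "Z \<in> Sel2_set D" "Y \<in> Sel2_set D"
  then obtain a x b y where Z_rep: "Z = square_class a" "sqfree_divisor D a" "x \<in> K" "Nm x = of_nat a"
    and Y_rep: "Y = square_class b" "sqfree_divisor D b" "y \<in> K" "Nm y = of_nat b"
    unfolding Sel2_set_eq by auto
  obtain g c where product: "g > 0" "sqfree_divisor D c" "a * b = c * g ^ 2"
      and mult: "square_class a \<otimes>\<^bsub>square_class_group\<^esub> square_class b = square_class c"
    using Z_rep(2) Y_rep(2) by (rule square_class_mult_sqfree_divisor)
  have "Nm (of_rat (inverse (of_nat g)) * (x * y)) = of_nat (a * b) / of_nat g ^ 2"
    using Z_rep Y_rep by (simp add: Nm_mult power_inverse divide_inverse)
  also have "\<dots> = of_nat c" unfolding product(3) using product(1) by simp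
  finally show "Z \<otimes>\<^bsub>square_class_group\<^esub> Y \<in> Sel2_set D"
    unfolding Z_rep(1) Y_rep(1) mult Sel2_set_eq using product(2) Z_rep(3) Y_rep(3) by blast
qed

lemma group_Sel2: "group (Sel2 D)"
  unfolding Sel2_def
  using Sel2_subgroup square_classes.is_group by (rule subgroup.subgroup_is_group)

lemma group_Cl2_2: "group (Cl2_2 D)"
  unfolding Cl2_2_def
  by (intro subgroup.subgroup_is_group squares_2torsion_subgroup narrow_classes.comm_group_axioms
      narrow_classes.is_group)

definition cl :: "rat set \<Rightarrow> complex set set" where
  "cl Z = narrow_class D (ambiguous_ideal D (THE a. sqfree_divisor D a \<and> square_class a = Z))"

lemma cl_square_class:
  assumes "sqfree_divisor D a"
  shows "cl (square_class a) = narrow_class D (ambiguous_ideal D a)"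
proof -
  have "(THE b. sqfree_divisor D b \<and> square_class b = square_class a) = a"
    using assms square_class_inject by (intro the_equality) (auto simp: sqfree_divisor_def)
  thus ?thesis by (simp add: cl_def)
qed

lemma cl_square_class_ambig: "sqfree_divisor D a \<Longrightarrow> cl (square_class a) = narrow_class D (ambig a)"
  by (simp add: cl_square_class ambiguous_ideal_eq)

lemma cl_image_Sel2: "cl ` Sel2_set D = squares_2torsion Cl"
  unfolding Sel2_set_eq squares_2torsion_eq_ambig by (force simp: cl_square_class_ambig)

lemma cl_mult:
  assumes "sqfree_divisor D a" "sqfree_divisor D b"
  shows "cl (square_class a \<otimes>\<^bsub>square_class_group\<^esub> square_class b) =
           cl (square_class a) \<otimes>\<^bsub>Cl\<^esub> cl (square_class b)"
proof -
  obtain g c where product: "g > 0" "sqfree_divisor D c" "a * b = c * g ^ 2"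
      and mult: "square_class a \<otimes>\<^bsub>square_class_group\<^esub> square_class b = square_class c"
    using assms by (rule square_class_mult_sqfree_divisor)
  have "cl (square_class a \<otimes>\<^bsub>square_class_group\<^esub> square_class b) = narrow_class D (ambig c)"
    unfolding mult using product(2) by (rule cl_square_class_ambig)
  also have "\<dots> = narrow_class D (principal_ideal (of_nat g) \<star> ambig c)"
    using product(1,2) totally_positive_of_rat[of "of_nat g"]
    by (simp add: narrow_class_principal_ideal_prod frac_ideal_ambig)
  also have "\<dots> = narrow_class D (ambig a \<star> ambig b)"
    using assms product by (simp add: ambig_prod)
  also have "\<dots> = cl (square_class a) \<otimes>\<^bsub>Cl\<^esub> cl (square_class b)"
    using assms by (simp add: narrow_class_prod frac_ideal_ambig cl_square_class_ambig)
  finally show ?thesis .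
qed

lemma group_hom_cl: "group_hom (Sel2 D) (Cl2_2 D) cl"
proof (intro group_hom.intro group_hom_axioms.intro group_Sel2 group_Cl2_2 homI)
  show "cl Z \<in> carrier (Cl2_2 D)" if "Z \<in> carrier (Sel2 D)" for Z
    using that cl_image_Sel2 by auto
  fix Z Y assume "Z \<in> carrier (Sel2 D)" "Y \<in> carrier (Sel2 D)"
  then obtain a b where "Z = square_class a" "sqfree_divisor D a"
      "Y = square_class b" "sqfree_divisor D b"
    by (auto simp: Sel2_set_eq)
  thus "cl (Z \<otimes>\<^bsub>Sel2 D\<^esub> Y) = cl Z \<otimes>\<^bsub>Cl2_2 D\<^esub> cl Y" by (simp only: Sel2_simps Cl2_2_simps cl_mult)
qed

lemma W2_set_subset_Sel2_set: "W2_set D \<subseteq> Sel2_set D"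
  unfolding W2_set_eq Sel2_set_eq using ambig_narrow_principal_iff ambig_in_quad_field by blast

lemma kernel_cl: "kernel (Sel2 D) (Cl2_2 D) cl = W2_set D"
  using W2_set_subset_Sel2_set unfolding kernel_def Sel2_simps Cl2_2_simps
  by (auto simp: W2_set_eq Sel2_set_eq cl_square_class_ambig)

end

theorem theorem6p4:
  fixes d D :: int
  assumes "squarefree d" and "d \<noteq> 1" and "D = quad_disc d"
  shows "(\<exists>cl. (\<forall>a. sqfree_divisor D a \<and> square_class a \<in> Sel2_set D \<longrightarrow>
                    cl (square_class a) = narrow_class D (ambiguous_ideal D a)) \<and>
               short_exact (W2 D) (Sel2 D) (Cl2_2 D) id cl) \<and>
         Sha2 D \<cong> Cl2_2 D"
proof -
  interpret fundamental_quadratic_field D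
    using assms fundamental_discriminant_quad_disc by unfold_locales simp
  have surjective: "cl ` carrier (Sel2 D) = carrier (Cl2_2 D)" using cl_image_Sel2 by simp
  have "short_exact (W2 D) (Sel2 D) (Cl2_2 D) id cl"
    using short_exact_kernel[OF group_hom_cl surjective] by (simp add: W2_def kernel_cl)
  moreover have "Sha2 D \<cong> Cl2_2 D"
    using group_hom.FactGroup_iso[OF group_hom_cl surjective] by (simp add: Sha2_def kernel_cl)
  ultimately show ?thesis using cl_square_class by blast
qed

end
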